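(* For every $p\in[1,2]$, $$\beta_p^*\left((\mathbb Z\wr\mathbb Z)_0,\,d_{\mathbb Z\wr\mathbb Z}\right)=\frac{2}{p+1}.$$
   Context: The (restricted) wreath product $\mathbb Z\wr\mathbb Z$ is the group of all pairs $(f,x)$ where $x\in\mathbb Z$ and $f:\mathbb Z\to\mathbb Z$ has finite support, with product $(f,x)(g,y)=\left(z\mapsto f(z)+g(z-x),\,x+y\right)$. $d_{\mathbb Z\wr\mathbb Z}$ is the left-invariant word metric associated with the generators $(\mathbf 0,\pm1)$ and $(\pm\mathbf 1_{\{0\}},0)$. The zero section is the subgroup $\Gamma=(\mathbb Z\wr\mathbb Z)_0=\{(f,x)\in\mathbb Z\wr\mathbb Z:\ x=0\}$, equipped with the restriction $\rho$ of $d_{\mathbb Z\wr\mathbb Z}$. For a group $\Gamma$ with a left-invariant metric $\rho$ all of whose balls are finite: a probability measure $\mu$ on $\Gamma$ is symmetric if $\mu(\{g\})=\mu(\{g^{-1}\})$ for all $g$. For such $\mu$ let $g_1,g_2,\dots$ be i.i.d. elements of $\Gamma$ with law $\mu$, and set $W_0^\mu=e_\Gamma$, $W_t^\mu=g_1g_2\cdots g_t$. For a sequence $\{\mu_t\}_{t=1}^\infty$ of symmetric probability measures on $\Gamma$ put $$\beta_p^*\left(\{\mu_t\}_{t=1}^\infty,\rho\right)=\limsup_{t\to\infty}\frac{\log\left(\mathbb E_{\mu_t}\left[\rho(W_t^{\mu_t},e_\Gamma)\right]\right)}{\log\left(t\,\mathbb E_{\mu_t}\left[\rho(W_1^{\mu_t},e_\Gamma)^p\right]\right)}.$$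 $\beta_p^*(\Gamma,\rho)$ is the supremum of $\beta_p^*(\{\mu_t\}_{t=1}^\infty,\rho)$ over all sequences of symmetric probability measures on $\Gamma$ with $\int_\Gamma\rho(x,e_\Gamma)^p\,d\mu_t(x)<\infty$ for all $t\in\mathbb N$ and $\lim_{t\to\infty}t\,\mu_t(\Gamma\setminus\{e_\Gamma\})=\infty$. *)

theory Defs
  imports "HOL-Algebra.Group" "HOL-Probability.Probability"
begin

definition wreath_ZZ :: "((int \<Rightarrow> int) \<times> int) monoid" where
  "wreath_ZZ =
    \<lparr>carrier = {(f, x). finite {z. f z \<noteq> 0}},
     monoid.mult = (\<lambda>(f, x) (g, y). (\<lambda>z. f z + g (z - x), x + y)),
     one = (\<lambda>_. 0, 0)\<rparr>"

lemma group_wreath_ZZ: "group wreath_ZZ"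
proof (rule groupI)
  fix a b assume "a \<in> carrier wreath_ZZ" "b \<in> carrier wreath_ZZ"
  then obtain f x g y where ab: "a = (f, x)" "b = (g, y)"
    and fin: "finite {z. f z \<noteq> 0}" "finite {z. g z \<noteq> 0}"
    by (auto simp: wreath_ZZ_def)
  have "finite ((\<lambda>z. z + x) ` {z. g z \<noteq> 0})"
    using fin by simp
  moreover have "{z. f z + g (z - x) \<noteq> 0} \<subseteq> {z. f z \<noteq> 0} \<union> (\<lambda>z. z + x) ` {z. g z \<noteq> 0}"
    by (auto simp: image_iff) (metis add.right_neutral diff_add_cancel)
  ultimately have "finite {z. f z + g (z - x) \<noteq> 0}"
    using fin finite_subset by blast
  then show "a \<otimes>\<^bsub>wreath_ZZ\<^esub> b \<in> carrier wreath_ZZ"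
    by (simp add: ab wreath_ZZ_def)
next
  fix a assume "a \<in> carrier wreath_ZZ"
  then obtain f x where a: "a = (f, x)" and fin: "finite {z. f z \<noteq> 0}"
    by (auto simp: wreath_ZZ_def)
  have "{z. f (z + x) \<noteq> 0} \<subseteq> (\<lambda>z. z - x) ` {z. f z \<noteq> 0}"
    by (auto simp: image_iff) (metis add_diff_cancel_right')
  then have "finite {z. f (z + x) \<noteq> 0}"
    using fin by (meson finite_imageI finite_subset)
  then have "(\<lambda>z. - f (z + x), - x) \<in> carrier wreath_ZZ"
    by (simp add: wreath_ZZ_def)
  moreover have "(\<lambda>z. - f (z + x), - x) \<otimes>\<^bsub>wreath_ZZ\<^esub> a = \<one>\<^bsub>wreath_ZZ\<^esub>"
    by (simp add: a wreath_ZZ_def)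
  ultimately show "\<exists>b\<in>carrier wreath_ZZ. b \<otimes>\<^bsub>wreath_ZZ\<^esub> a = \<one>\<^bsub>wreath_ZZ\<^esub>"
    by blast
qed (auto simp: wreath_ZZ_def algebra_simps)

definition wreath_ZZ_gens :: "((int \<Rightarrow> int) \<times> int) set" where
  "wreath_ZZ_gens =
    {(\<lambda>_. 0, 1), (\<lambda>_. 0, - 1),
     (indicator {0}, 0), (\<lambda>z. - indicator {0} z, 0)}"

definition zero_section :: "((int \<Rightarrow> int) \<times> int) monoid" where
  "zero_section = wreath_ZZ\<lparr>carrier := {(f, x) \<in> carrier wreath_ZZ. x = 0}\<rparr>"

lemma subgroup_zero_section: "subgroup (carrier zero_section) wreath_ZZ"
proof -
  interpret group wreath_ZZ by (rule group_wreath_ZZ)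
  have sub: "carrier zero_section \<subseteq> carrier wreath_ZZ"
    by (auto simp: zero_section_def)
  have snd_mult: "snd (a \<otimes>\<^bsub>wreath_ZZ\<^esub> b) = snd a + snd b" for a b
    by (cases a; cases b) (simp add: wreath_ZZ_def)
  have iff: "a \<in> carrier zero_section \<longleftrightarrow> a \<in> carrier wreath_ZZ \<and> snd a = 0" for a
    by (cases a) (simp add: zero_section_def)
  show ?thesis
  proof (rule subgroupI[OF sub])
    have "\<one>\<^bsub>wreath_ZZ\<^esub> \<in> carrier zero_section"
      by (simp add: zero_section_def wreath_ZZ_def)
    then show "carrier zero_section \<noteq> {}" by blast
  next
    fix a assume a: "a \<in> carrier zero_section"
    then have "snd (inv\<^bsub>wreath_ZZ\<^esub> a \<otimes>\<^bsub>wreath_ZZ\<^esub> a) = 0"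
      using iff by (simp add: l_inv) (simp add: wreath_ZZ_def)
    then show "inv\<^bsub>wreath_ZZ\<^esub> a \<in> carrier zero_section"
      using a iff snd_mult by simp
  qed (auto simp: iff snd_mult)
qed

lemma group_zero_section: "group zero_section"
proof -
  have "zero_section = wreath_ZZ\<lparr>carrier := carrier zero_section\<rparr>"
    by (simp add: zero_section_def)
  then show ?thesis
    using group.subgroup_imp_group[OF group_wreath_ZZ subgroup_zero_section] by simp
qed

definition word_norm :: "('a, 'b) monoid_scheme \<Rightarrow> 'a set \<Rightarrow> 'a \<Rightarrow> nat" where
  "word_norm G S g =
    (LEAST n. \<exists>ws. length ws = n \<and> set ws \<subseteq> S \<and> foldr (\<otimes>\<^bsub>G\<^esub>) ws \<one>\<^bsub>G\<^esub> = g)"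

lemma wreath_ZZ_generated:
  assumes "g \<in> carrier wreath_ZZ"
  shows "\<exists>ws. set ws \<subseteq> wreath_ZZ_gens \<and> foldr (\<otimes>\<^bsub>wreath_ZZ\<^esub>) ws \<one>\<^bsub>wreath_ZZ\<^esub> = g"
proof -
  interpret group wreath_ZZ by (rule group_wreath_ZZ)
  define R where "R = (\<lambda>ws. foldr (\<otimes>\<^bsub>wreath_ZZ\<^esub>) ws \<one>\<^bsub>wreath_ZZ\<^esub>) ` lists wreath_ZZ_gens"
  have gens: "wreath_ZZ_gens \<subseteq> carrier wreath_ZZ"
    by (auto simp: wreath_ZZ_gens_def wreath_ZZ_def indicator_def)
  have closed: "foldr (\<otimes>\<^bsub>wreath_ZZ\<^esub>) us \<one>\<^bsub>wreath_ZZ\<^esub> \<in> carrier wreath_ZZ"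
    if "us \<in> lists wreath_ZZ_gens" for us
    using that gens by (induction us) auto
  have app: "foldr (\<otimes>\<^bsub>wreath_ZZ\<^esub>) (us @ vs) \<one>\<^bsub>wreath_ZZ\<^esub> =
      foldr (\<otimes>\<^bsub>wreath_ZZ\<^esub>) us \<one>\<^bsub>wreath_ZZ\<^esub> \<otimes>\<^bsub>wreath_ZZ\<^esub> foldr (\<otimes>\<^bsub>wreath_ZZ\<^esub>) vs \<one>\<^bsub>wreath_ZZ\<^esub>"
    if "us \<in> lists wreath_ZZ_gens" "vs \<in> lists wreath_ZZ_gens" for us vs
    using that(1)
  proof (induction us)
    case Nil
    then show ?case using closed[OF that(2)] by simp
  next
    case (Cons a us)
    then show ?case
      using closed[OF Cons.hyps(2)] closed[OF that(2)] gens by (auto simp: m_assoc)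
  qed
  have R_mult: "a \<otimes>\<^bsub>wreath_ZZ\<^esub> b \<in> R" if ab: "a \<in> R" "b \<in> R" for a b
  proof -
    obtain us vs where uv: "us \<in> lists wreath_ZZ_gens" "vs \<in> lists wreath_ZZ_gens"
      and eq: "a = foldr (\<otimes>\<^bsub>wreath_ZZ\<^esub>) us \<one>\<^bsub>wreath_ZZ\<^esub>"
        "b = foldr (\<otimes>\<^bsub>wreath_ZZ\<^esub>) vs \<one>\<^bsub>wreath_ZZ\<^esub>"
      using ab unfolding R_def by blast
    show ?thesis
      unfolding R_def eq app[OF uv, symmetric]
      using uv by (intro imageI) simp
  qed
  have R_gen: "a \<in> R" if "a \<in> wreath_ZZ_gens" for a
    unfolding R_def using that gens by (intro image_eqI[of _ _ "[a]"]) auto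
  have R_one: "(\<lambda>_. 0, 0) \<in> R"
    unfolding R_def by (intro image_eqI[of _ _ "[]"]) (auto simp: wreath_ZZ_def)
  have shift: "(\<lambda>_. 0, x) \<in> R" for x
  proof (induction x rule: int_induct[where k = 0])
    case (step1 i)
    then show ?case
      using R_mult[OF step1(2) R_gen, of "(\<lambda>_. 0, 1)"]
      by (simp add: wreath_ZZ_def wreath_ZZ_gens_def)
  next
    case (step2 i)
    then show ?case
      using R_mult[OF step2(2) R_gen, of "(\<lambda>_. 0, - 1)"]
      by (simp add: wreath_ZZ_def wreath_ZZ_gens_def)
  qed (rule R_one)
  have lamp0: "(\<lambda>z. c * indicator {0} z, 0) \<in> R" for c
  proof (induction c rule: int_induct[where k = 0])
    case (step1 i)
    then show ?case
      using R_mult[OF step1(2) R_gen, of "(indicator {0}, 0)"]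
      by (simp add: wreath_ZZ_def wreath_ZZ_gens_def algebra_simps)
  next
    case (step2 i)
    then show ?case
      using R_mult[OF step2(2) R_gen, of "(\<lambda>z. - indicator {0} z, 0)"]
      by (simp add: wreath_ZZ_def wreath_ZZ_gens_def algebra_simps)
  qed (use R_one in simp)
  have lamp: "(\<lambda>z. c * indicator {0} (z - k), 0) \<in> R" for c k
    using R_mult[OF R_mult[OF shift[of k] lamp0[of c]] shift[of "- k"]]
    by (simp add: wreath_ZZ_def)
  have zero: "(f, 0) \<in> R" if "finite A" "{z. f z \<noteq> 0} \<subseteq> A" for A and f :: "int \<Rightarrow> int"
    using that
  proof (induction A arbitrary: f rule: finite_induct)
    case empty
    then have "f = (\<lambda>_. 0)" by auto
    then show ?case using R_one by simp
  next
    case (insert k A)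
    have "(f(k := 0), 0) \<in> R"
      by (rule insert.IH) (use insert.prems in auto)
    from R_mult[OF this lamp[of "f k" k]]
    have "(\<lambda>z. (f(k := 0)) z + f k * indicator {0} (z - k), 0) \<in> R"
      by (simp add: wreath_ZZ_def)
    also have "(\<lambda>z. (f(k := 0)) z + f k * indicator {0} (z - k)) = f"
      by (auto simp: fun_eq_iff indicator_def)
    finally show ?case .
  qed
  obtain f x where g: "g = (f, x)" "finite {z. f z \<noteq> 0}"
    using assms by (auto simp: wreath_ZZ_def)
  have "g \<in> R"
    using R_mult[OF zero[OF g(2) subset_refl] shift[of x]] by (simp add: g wreath_ZZ_def)
  then show ?thesis
    unfolding R_def by auto
qed

(* Meaningful when S is a symmetric generating set of G. *)
definition word_metric :: "('a, 'b) monoid_scheme \<Rightarrow> 'a set \<Rightarrow> 'a \<Rightarrow> 'a \<Rightarrow> real" where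
  "word_metric G S g h = real (word_norm G S (inv\<^bsub>G\<^esub> g \<otimes>\<^bsub>G\<^esub> h))"

(* A group with a left-invariant metric whose balls are finite is countable, so its probability
   measures are the pmfs on the ambient type that are supported in the carrier. *)
definition symmetric_pmf :: "('a, 'b) monoid_scheme \<Rightarrow> 'a pmf \<Rightarrow> bool" where
  "symmetric_pmf G \<mu> \<longleftrightarrow>
    set_pmf \<mu> \<subseteq> carrier G \<and> (\<forall>g\<in>carrier G. pmf \<mu> g = pmf \<mu> (inv\<^bsub>G\<^esub> g))"

definition walk :: "('a, 'b) monoid_scheme \<Rightarrow> 'a pmf \<Rightarrow> nat \<Rightarrow> 'a pmf" where
  "walk G \<mu> t = map_pmf (\<lambda>gs. foldr (\<otimes>\<^bsub>G\<^esub>) gs \<one>\<^bsub>G\<^esub>) (replicate_pmf t \<mu>)"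

(* The quotient is a real number although E[rho(W_t, e)] = 0 would call for ln 0 = -\<infinity>: under the
   conditions of admissible_walks this needs t * \<mu> t (G - {e}) to stay large while W_t = e
   almost surely, which forces an element of order two, and zero_section has none.
   The denominator is positive for all large t. *)
definition beta_star_seq ::
    "('a, 'b) monoid_scheme \<Rightarrow> ('a \<Rightarrow> 'a \<Rightarrow> real) \<Rightarrow> real \<Rightarrow> (nat \<Rightarrow> 'a pmf) \<Rightarrow> ereal" where
  "beta_star_seq G \<rho> p \<mu> =
    limsup (\<lambda>t. ereal
      (ln (measure_pmf.expectation (walk G (\<mu> t) t) (\<lambda>x. \<rho> x \<one>\<^bsub>G\<^esub>)) /
       ln (real t * measure_pmf.expectation (walk G (\<mu> t) 1) (\<lambda>x. \<rho> x \<one>\<^bsub>G\<^esub> powr p))))"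

(* Sequences are indexed by t \<ge> 1; the value at t = 0 is irrelevant. *)
definition admissible_walks ::
    "('a, 'b) monoid_scheme \<Rightarrow> ('a \<Rightarrow> 'a \<Rightarrow> real) \<Rightarrow> real \<Rightarrow> (nat \<Rightarrow> 'a pmf) set" where
  "admissible_walks G \<rho> p =
    {\<mu>. (\<forall>t\<ge>1. symmetric_pmf G (\<mu> t) \<and>
               integrable (measure_pmf (\<mu> t)) (\<lambda>x. \<rho> x \<one>\<^bsub>G\<^esub> powr p)) \<and>
        filterlim (\<lambda>t. real t * measure_pmf.prob (\<mu> t) (carrier G - {\<one>\<^bsub>G\<^esub>}))
          at_top sequentially}"

(* For p \<ge> 1 integrability of \<rho>^p makes all Bochner expectations above genuine. *)
definition beta_star ::
    "('a, 'b) monoid_scheme \<Rightarrow> ('a \<Rightarrow> 'a \<Rightarrow> real) \<Rightarrow> real \<Rightarrow> ereal" where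
  "beta_star G \<rho> p = (SUP \<mu>\<in>admissible_walks G \<rho> p. beta_star_seq G \<rho> p \<mu>)"

end

theory Submission
  imports Defs
begin

text \<open>
  The zero section is the abelian group of finitely supported functions \<open>f\<close> from the integers to
  the integers. Up to constants the norm of \<open>f\<close> is its \<open>L\<^sup>1\<close> norm plus the radius of its support,
  the cost of a travelling salesman tour on the line: see \<open>sum_abs_le_wr_norm\<close> and
  \<open>support_le_wr_norm\<close> for the lower bounds, \<open>wr_norm_le_sum_abs\<close> for the upper one.

  Upper bound (\<open>expectation_norm_le\<close>). Let \<open>S\<close> be \<open>t\<close> times the \<open>p\<close>-th moment of the norm of one
  increment, and truncate at norm \<open>R\<close>. By the triangle inequality the large increments
  contribute at most \<open>S * R powr (1 - p)\<close> to the expected norm. The small ones live on the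
  \<open>O(R)\<close> lamps of \<open>{- R..R}\<close>, so their tour costs \<open>O(R)\<close>. By symmetry they are orthogonal
  (\<open>second_moment_symmetric_sum\<close>), so the squared heights of the lamps add up in expectation to at
  most \<open>S * R powr (2 - p)\<close>, and the \<open>L\<^sup>1\<close> norm is of order at most
  \<open>S * R powr (1 - p) + R\<^sup>2\<close>. At \<open>R = S powr (1 / (p + 1))\<close> everything is of order
  \<open>R\<^sup>2 = S powr (2 / (p + 1))\<close>. Admissibility forces \<open>S\<close> to tend to infinity, which makes the
  constant disappear in the quotient of logarithms (\<open>beta_star_seq_le\<close>).

  Lower bound (\<open>beta_star_seq_spread_pmf_ge\<close>). At time \<open>t\<close> let an increment change one uniformly
  chosen lamp among \<open>{0..<t}\<close> by \<open>t\<close> or \<open>- t\<close>. Increments have norm of order \<open>t\<close>, so \<open>S\<close> is of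
  order \<open>t powr (p + 1)\<close>. After \<open>t\<close> steps each lamp is at an odd multiple of \<open>t\<close> with probability
  bounded below, as the mean of the parity character shows, so the expected norm is at least of
  order \<open>t\<^sup>2\<close> (\<open>expectation_norm_spread_pmf_ge\<close>).
\<close>

section \<open>Word norms\<close>

lemma word_norm_le:
  assumes "set ws \<subseteq> S"
  shows "word_norm G S (foldr (\<otimes>\<^bsub>G\<^esub>) ws \<one>\<^bsub>G\<^esub>) \<le> length ws"
  unfolding word_norm_def by (rule Least_le) (use assms in auto)

lemma word_norm_attained:
  assumes "\<exists>ws. set ws \<subseteq> S \<and> foldr (\<otimes>\<^bsub>G\<^esub>) ws \<one>\<^bsub>G\<^esub> = g"
  obtains ws where "set ws \<subseteq> S" "foldr (\<otimes>\<^bsub>G\<^esub>) ws \<one>\<^bsub>G\<^esub> = g" "length ws = word_norm G S g"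
proof -
  have "\<exists>n ws. length ws = n \<and> set ws \<subseteq> S \<and> foldr (\<otimes>\<^bsub>G\<^esub>) ws \<one>\<^bsub>G\<^esub> = g"
    using assms by blast
  from LeastI_ex[OF this] show thesis
    using that unfolding word_norm_def by blast
qed

lemma (in group) foldr_mult_closed:
  assumes "set ws \<subseteq> carrier G"
  shows "foldr (\<otimes>) ws \<one> \<in> carrier G"
  using assms by (induction ws) auto

lemma (in group) foldr_mult_append:
  assumes "set us \<subseteq> carrier G" "set vs \<subseteq> carrier G"
  shows "foldr (\<otimes>) (us @ vs) \<one> = foldr (\<otimes>) us \<one> \<otimes> foldr (\<otimes>) vs \<one>"
  using assms by (induction us) (auto simp: foldr_mult_closed m_assoc simp del: foldr_append)

lemma (in group) inv_foldr_mult: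
  assumes "set ws \<subseteq> carrier G"
  shows "inv (foldr (\<otimes>) ws \<one>) = foldr (\<otimes>) (rev (map (\<lambda>x. inv x) ws)) \<one>"
  using assms
proof (induction ws)
  case (Cons a ws)
  have "set (rev (map (\<lambda>x. inv x) ws)) \<subseteq> carrier G" "set [inv a] \<subseteq> carrier G"
    using Cons.prems by auto
  from foldr_mult_append[OF this] show ?case
    using Cons by (simp add: inv_mult_group foldr_mult_closed del: foldr_append)
qed simp

lemma (in group) word_norm_mult_le:
  assumes "S \<subseteq> carrier G"
    and "\<exists>ws. set ws \<subseteq> S \<and> foldr (\<otimes>) ws \<one> = g"
    and "\<exists>ws. set ws \<subseteq> S \<and> foldr (\<otimes>) ws \<one> = h"
  shows "word_norm G S (g \<otimes> h) \<le> word_norm G S g + word_norm G S h"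
proof -
  obtain us where us: "set us \<subseteq> S" "foldr (\<otimes>) us \<one> = g" "length us = word_norm G S g"
    using word_norm_attained[OF assms(2)] .
  obtain vs where vs: "set vs \<subseteq> S" "foldr (\<otimes>) vs \<one> = h" "length vs = word_norm G S h"
    using word_norm_attained[OF assms(3)] .
  have "foldr (\<otimes>) (us @ vs) \<one> = g \<otimes> h"
    using foldr_mult_append[of us vs] us vs assms(1) by auto
  then show ?thesis
    using word_norm_le[of "us @ vs" S G] us vs by auto
qed

lemma (in group) word_norm_inv_le:
  assumes "S \<subseteq> carrier G" "\<And>s. s \<in> S \<Longrightarrow> inv s \<in> S"
    and "\<exists>ws. set ws \<subseteq> S \<and> foldr (\<otimes>) ws \<one> = g"
  shows "word_norm G S (inv g) \<le> word_norm G S g"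
proof -
  obtain us where us: "set us \<subseteq> S" "foldr (\<otimes>) us \<one> = g" "length us = word_norm G S g"
    using word_norm_attained[OF assms(3)] .
  have "inv g = foldr (\<otimes>) (rev (map (\<lambda>x. inv x) us)) \<one>"
    using inv_foldr_mult[of us] us assms(1) by auto
  then show ?thesis
    using word_norm_le[of "rev (map (\<lambda>x. inv x) us)" S G] us assms(2) by fastforce
qed

section \<open>The word norm of the lamplighter group\<close>

text \<open>The inverse formula is taken on the whole ambient type, where it is an injective involution.
  Symmetry of a law then becomes the equation \<open>map_pmf wr_inv \<mu> = \<mu>\<close>.\<close>

definition wr_inv :: "(int \<Rightarrow> int) \<times> int \<Rightarrow> (int \<Rightarrow> int) \<times> int" where
  "wr_inv g = (\<lambda>z. - fst g (z + snd g), - snd g)"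

abbreviation wr_norm :: "(int \<Rightarrow> int) \<times> int \<Rightarrow> nat" where
  "wr_norm \<equiv> word_norm wreath_ZZ wreath_ZZ_gens"

lemma wr_inv_wr_inv [simp]: "wr_inv (wr_inv g) = g"
  by (simp add: wr_inv_def)

lemma inj_wr_inv: "inj wr_inv"
  by (rule inj_on_inverseI[where g = wr_inv]) simp

lemma mult_wreath_ZZ: "g \<otimes>\<^bsub>wreath_ZZ\<^esub> h = (\<lambda>z. fst g z + fst h (z - snd g), snd g + snd h)"
  by (simp add: wreath_ZZ_def case_prod_unfold)

lemma one_wreath_ZZ: "\<one>\<^bsub>wreath_ZZ\<^esub> = (\<lambda>_. 0, 0)"
  by (simp add: wreath_ZZ_def)

lemma carrier_wreath_ZZ: "g \<in> carrier wreath_ZZ \<longleftrightarrow> finite {z. fst g z \<noteq> 0}"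
  by (cases g) (simp add: wreath_ZZ_def)

lemma inv_wreath_ZZ:
  assumes "g \<in> carrier wreath_ZZ"
  shows "inv\<^bsub>wreath_ZZ\<^esub> g = wr_inv g"
proof -
  interpret group wreath_ZZ by (rule group_wreath_ZZ)
  have "{z. fst g (z + snd g) \<noteq> 0} \<subseteq> (\<lambda>z. z - snd g) ` {z. fst g z \<noteq> 0}"
    by (auto simp: image_iff) (metis add_diff_cancel_right')
  then have "finite {z. fst g (z + snd g) \<noteq> 0}"
    using assms unfolding carrier_wreath_ZZ by (meson finite_imageI finite_subset)
  then show ?thesis
    using assms
    by (intro inv_equality)
      (auto simp: mult_wreath_ZZ one_wreath_ZZ carrier_wreath_ZZ wr_inv_def)
qed

lemma wreath_ZZ_gens_carrier: "wreath_ZZ_gens \<subseteq> carrier wreath_ZZ"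
  by (auto simp: wreath_ZZ_gens_def wreath_ZZ_def indicator_def)

lemma wr_norm_one: "wr_norm \<one>\<^bsub>wreath_ZZ\<^esub> = 0"
  using word_norm_le[of "[]" wreath_ZZ_gens wreath_ZZ] by simp

lemma wr_norm_gen: "s \<in> wreath_ZZ_gens \<Longrightarrow> wr_norm s \<le> 1"
  using word_norm_le[of "[s]" wreath_ZZ_gens wreath_ZZ]
  by (cases s) (simp add: mult_wreath_ZZ one_wreath_ZZ)

lemma wr_norm_mult_le:
  "\<lbrakk>g \<in> carrier wreath_ZZ; h \<in> carrier wreath_ZZ\<rbrakk>
    \<Longrightarrow> wr_norm (g \<otimes>\<^bsub>wreath_ZZ\<^esub> h) \<le> wr_norm g + wr_norm h"
  by (intro group.word_norm_mult_le group_wreath_ZZ wreath_ZZ_gens_carrier wreath_ZZ_generated)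

lemma wr_norm_wr_inv:
  assumes "g \<in> carrier wreath_ZZ"
  shows "wr_norm (wr_inv g) = wr_norm g"
proof -
  interpret group wreath_ZZ by (rule group_wreath_ZZ)
  have gens: "inv\<^bsub>wreath_ZZ\<^esub> s \<in> wreath_ZZ_gens" if "s \<in> wreath_ZZ_gens" for s
    using that wreath_ZZ_gens_carrier
    by (subst inv_wreath_ZZ) (auto simp: wreath_ZZ_gens_def wr_inv_def)
  have le: "wr_norm (wr_inv h) \<le> wr_norm h" if "h \<in> carrier wreath_ZZ" for h
    using word_norm_inv_le[OF wreath_ZZ_gens_carrier gens wreath_ZZ_generated[OF that]]
      inv_wreath_ZZ[OF that] by simp
  have "wr_inv g \<in> carrier wreath_ZZ"
    using inv_closed[OF assms] inv_wreath_ZZ[OF assms] by simp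
  from le[OF this] le[OF assms] show ?thesis by simp
qed

lemma word_metric_one:
  assumes "g \<in> carrier wreath_ZZ"
  shows "word_metric wreath_ZZ wreath_ZZ_gens g \<one>\<^bsub>wreath_ZZ\<^esub> = real (wr_norm g)"
proof -
  interpret group wreath_ZZ by (rule group_wreath_ZZ)
  show ?thesis
    using assms by (simp add: word_metric_def wr_norm_wr_inv flip: inv_wreath_ZZ)
      (simp add: inv_wreath_ZZ wr_norm_wr_inv)
qed

lemma wr_norm_eq_0:
  assumes "g \<in> carrier wreath_ZZ" "wr_norm g = 0"
  shows "g = \<one>\<^bsub>wreath_ZZ\<^esub>"
  using word_norm_attained[OF wreath_ZZ_generated[OF assms(1)]] assms(2) by force

text \<open>Each letter of a word changes one lamp by one or moves the lamplighter by one. Peeling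
  letters off the front translates the configuration, so the bound is stated for the sum over
  an arbitrary finite window.\<close>

lemma word_bounds:
  assumes "set ws \<subseteq> wreath_ZZ_gens" "finite A"
  shows "(\<Sum>z\<in>A. \<bar>fst (foldr (\<otimes>\<^bsub>wreath_ZZ\<^esub>) ws \<one>\<^bsub>wreath_ZZ\<^esub>) z\<bar>) \<le> int (length ws)"
    and "fst (foldr (\<otimes>\<^bsub>wreath_ZZ\<^esub>) ws \<one>\<^bsub>wreath_ZZ\<^esub>) z \<noteq> 0 \<Longrightarrow> \<bar>z\<bar> \<le> int (length ws)"
proof -
  show "(\<Sum>z\<in>A. \<bar>fst (foldr (\<otimes>\<^bsub>wreath_ZZ\<^esub>) ws \<one>\<^bsub>wreath_ZZ\<^esub>) z\<bar>) \<le> int (length ws)"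
    using assms
  proof (induction ws arbitrary: A)
    case Nil
    then show ?case by (simp add: one_wreath_ZZ)
  next
    case (Cons s ws)
    let ?g = "foldr (\<otimes>\<^bsub>wreath_ZZ\<^esub>) ws \<one>\<^bsub>wreath_ZZ\<^esub>"
    have "(\<Sum>z\<in>A. \<bar>fst s z\<bar>) \<le> (\<Sum>z\<in>A. indicator {0} z)" if "snd s = 0"
      using Cons.prems(1) that by (intro sum_mono) (auto simp: wreath_ZZ_gens_def)
    also have "\<dots> \<le> (1::int)"
      using card_mono[of "{0}" "A \<inter> {0}"] Cons.prems(2) by (simp add: indicator_def)
    finally have s: "(\<Sum>z\<in>A. \<bar>fst s z\<bar>) \<le> 1"
      using Cons.prems(1) by (cases "snd s = 0") (auto simp: wreath_ZZ_gens_def)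
    have "(\<Sum>z\<in>A. \<bar>fst (s \<otimes>\<^bsub>wreath_ZZ\<^esub> ?g) z\<bar>) \<le> (\<Sum>z\<in>A. \<bar>fst s z\<bar> + \<bar>fst ?g (z - snd s)\<bar>)"
      by (intro sum_mono) (simp add: mult_wreath_ZZ)
    also have "\<dots> = (\<Sum>z\<in>A. \<bar>fst s z\<bar>) + (\<Sum>z\<in>(\<lambda>z. z - snd s) ` A. \<bar>fst ?g z\<bar>)"
      by (simp add: sum.distrib sum.reindex inj_on_def)
    also have "\<dots> \<le> 1 + int (length ws)"
      using Cons.prems by (intro add_mono s Cons.IH) auto
    finally show ?case by simp
  qed
  show "fst (foldr (\<otimes>\<^bsub>wreath_ZZ\<^esub>) ws \<one>\<^bsub>wreath_ZZ\<^esub>) z \<noteq> 0 \<Longrightarrow> \<bar>z\<bar> \<le> int (length ws)"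
    using assms(1)
  proof (induction ws arbitrary: z)
    case Nil
    then show ?case by (simp add: one_wreath_ZZ)
  next
    case (Cons s ws)
    let ?g = "foldr (\<otimes>\<^bsub>wreath_ZZ\<^esub>) ws \<one>\<^bsub>wreath_ZZ\<^esub>"
    have "fst s z \<noteq> 0 \<or> fst ?g (z - snd s) \<noteq> 0"
      using Cons.prems(1) mult_wreath_ZZ[of s ?g] by auto
    moreover have "z = 0" if "fst s z \<noteq> 0"
      using Cons.prems(2) that by (auto simp: wreath_ZZ_gens_def indicator_def split: if_splits)
    moreover have "\<bar>snd s\<bar> \<le> 1"
      using Cons.prems(2) by (auto simp: wreath_ZZ_gens_def)
    ultimately show ?case
      using Cons.IH[of "z - snd s"] Cons.prems(2) by fastforce
  qed
qed

lemma sum_abs_le_wr_norm: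
  assumes "g \<in> carrier wreath_ZZ" "finite A"
  shows "(\<Sum>z\<in>A. \<bar>fst g z\<bar>) \<le> int (wr_norm g)"
  using word_norm_attained[OF wreath_ZZ_generated[OF assms(1)]] word_bounds(1)[OF _ assms(2)]
  by metis

lemma support_le_wr_norm:
  assumes "g \<in> carrier wreath_ZZ" "fst g z \<noteq> 0"
  shows "\<bar>z\<bar> \<le> int (wr_norm g)"
  using word_norm_attained[OF wreath_ZZ_generated[OF assms(1)]] word_bounds(2)[of _ "{}" z] assms(2)
  by (metis finite.emptyI)

lemma wr_norm_shift_le: "wr_norm (\<lambda>_. 0, x) \<le> nat \<bar>x\<bar>"
proof -
  define y where "y = sgn x"
  have "wr_norm (\<lambda>_. 0, int n * y) \<le> n" for n
  proof (induction n)
    case 0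
    then show ?case using wr_norm_one by (simp add: one_wreath_ZZ)
  next
    case (Suc n)
    have "wr_norm (\<lambda>_. 0, y) \<le> 1"
      using wr_norm_gen[of "(\<lambda>_. 0, y)"] wr_norm_one
      by (auto simp: y_def sgn_if wreath_ZZ_gens_def one_wreath_ZZ)
    moreover have "wr_norm (\<lambda>_. 0, int (Suc n) * y) \<le> wr_norm (\<lambda>_. 0, int n * y) + wr_norm (\<lambda>_. 0, y)"
      using wr_norm_mult_le[of "(\<lambda>_. 0, int n * y)" "(\<lambda>_. 0, y)"]
      by (simp add: carrier_wreath_ZZ mult_wreath_ZZ algebra_simps)
    ultimately show ?case using Suc by simp
  qed
  from this[of "nat \<bar>x\<bar>"] show ?thesis
    by (simp add: y_def abs_mult_sgn)
qed

lemma lamp_carrier: "(\<lambda>z. c * indicator {0} z, x) \<in> carrier wreath_ZZ"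
  by (rule iffD2[OF carrier_wreath_ZZ finite_subset[of _ "{0}"]]) (auto simp: indicator_def)

lemma wr_norm_lamp_le: "wr_norm (\<lambda>z. c * indicator {0} z, 0) \<le> nat \<bar>c\<bar>"
proof -
  define y where "y = sgn c"
  have "wr_norm (\<lambda>z. int n * y * indicator {0} z, 0) \<le> n" for n
  proof (induction n)
    case 0
    then show ?case using wr_norm_one by (simp add: one_wreath_ZZ)
  next
    case (Suc n)
    let ?s = "(\<lambda>z::int. y * indicator {0} z, 0::int)"
    have "wr_norm ?s \<le> 1"
      using wr_norm_gen[of ?s] wr_norm_one
      by (auto simp: y_def sgn_if wreath_ZZ_gens_def one_wreath_ZZ)
    moreover have "wr_norm (\<lambda>z. int (Suc n) * y * indicator {0} z, 0)
        \<le> wr_norm (\<lambda>z. int n * y * indicator {0} z, 0) + wr_norm ?s"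
      using wr_norm_mult_le[OF lamp_carrier lamp_carrier, of "int n * y" 0 y 0]
      by (simp add: mult_wreath_ZZ algebra_simps)
    ultimately show ?case using Suc by simp
  qed
  from this[of "nat \<bar>c\<bar>"] show ?thesis
    by (simp add: y_def abs_mult_sgn)
qed

text \<open>The travelling salesman bound: walk to the left end of the interval, sweep it from left to
  right setting each lamp on the way, and return to the origin.\<close>

lemma wr_norm_le_sum_abs:
  assumes "\<And>z. f z \<noteq> 0 \<Longrightarrow> \<bar>z\<bar> \<le> int R"
  shows "int (wr_norm (f, 0)) \<le> (\<Sum>z=-int R..int R. \<bar>f z\<bar>) + 4 * int R + 2"
proof -
  define a where "a = - int R"
  define h where "h n = (\<lambda>z. if z \<in> {a..<a + int n} then f z else 0)" for n
  have carr: "(h n, x) \<in> carrier wreath_ZZ" for n x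
    by (rule iffD2[OF carrier_wreath_ZZ finite_subset[of _ "{a..<a + int n}"]])
       (auto simp: h_def)
  have sweep: "int (wr_norm (h n, a + int n)) \<le> \<bar>a\<bar> + int n + (\<Sum>z=a..<a + int n. \<bar>f z\<bar>)" for n
  proof (induction n)
    case 0
    have "h 0 = (\<lambda>_. 0)" by (simp add: h_def)
    then show ?case using wr_norm_shift_le[of a] by simp
  next
    case (Suc n)
    let ?l = "(\<lambda>z. f (a + int n) * indicator {0} z, 0::int)" and ?m = "(\<lambda>_. 0::int, 1::int)"
    have l: "?l \<in> carrier wreath_ZZ" and m: "?m \<in> carrier wreath_ZZ"
      by (rule lamp_carrier, simp add: carrier_wreath_ZZ)
    have lm: "?l \<otimes>\<^bsub>wreath_ZZ\<^esub> ?m \<in> carrier wreath_ZZ"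
      by (intro monoid.m_closed group.is_monoid group_wreath_ZZ l m)
    have "(h (Suc n), a + int (Suc n)) = (h n, a + int n) \<otimes>\<^bsub>wreath_ZZ\<^esub> (?l \<otimes>\<^bsub>wreath_ZZ\<^esub> ?m)"
      by (auto simp: mult_wreath_ZZ h_def indicator_def fun_eq_iff)
    then have "wr_norm (h (Suc n), a + int (Suc n)) \<le> wr_norm (h n, a + int n) + (wr_norm ?l + wr_norm ?m)"
      using wr_norm_mult_le[OF carr lm, of n "a + int n"] wr_norm_mult_le[OF l m] by simp
    moreover have "wr_norm ?l \<le> nat \<bar>f (a + int n)\<bar>" by (rule wr_norm_lamp_le)
    moreover have "wr_norm ?m \<le> 1" using wr_norm_shift_le[of 1] by simp
    moreover have "{a..<a + int (Suc n)} = insert (a + int n) {a..<a + int n}" by auto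
    ultimately show ?case using Suc by simp
  qed
  have set: "{a..<a + int (2 * R + 1)} = {-int R..int R}" by (auto simp: a_def)
  have "h (2 * R + 1) = f"
    using assms unfolding h_def set by (force simp: fun_eq_iff)
  then have sw: "int (wr_norm (f, int R + 1)) \<le> 3 * int R + 1 + (\<Sum>z=-int R..int R. \<bar>f z\<bar>)"
    using sweep[of "2 * R + 1"] unfolding set by (simp add: a_def algebra_simps)
  let ?b = "(\<lambda>_. 0::int, - (int R + 1))"
  have "(f, 0) = (f, int R + 1) \<otimes>\<^bsub>wreath_ZZ\<^esub> ?b"
    by (simp add: mult_wreath_ZZ)
  moreover have "(f, int R + 1) \<in> carrier wreath_ZZ"
    using carr[of "2 * R + 1" "int R + 1"] \<open>h (2 * R + 1) = f\<close> by simp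
  ultimately have "wr_norm (f, 0) \<le> wr_norm (f, int R + 1) + wr_norm ?b"
    using wr_norm_mult_le[of "(f, int R + 1)" ?b] by (simp add: carrier_wreath_ZZ)
  also have "wr_norm ?b \<le> nat (int R + 1)"
    using wr_norm_shift_le[of "- (int R + 1)"] by simp
  finally show ?thesis using sw by linarith
qed

section \<open>Moments of sums of independent samples\<close>

lemma replicate_pmf_Suc_pair:
  "replicate_pmf (Suc n) p = map_pmf (\<lambda>x. fst x # snd x) (pair_pmf p (replicate_pmf n p))"
  by (simp add: pair_pmf_def map_bind_pmf map_pmf_def[symmetric] bind_return_pmf pmf.map_comp o_def)

lemma integrable_pair_pmf_fst:
  fixes h :: "'a \<Rightarrow> real"
  assumes "integrable (measure_pmf p) h"
  shows "integrable (measure_pmf (pair_pmf p q)) (\<lambda>x. h (fst x))"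
  using assms integrable_map_pmf_eq[of fst "pair_pmf p q" h] by (simp add: map_fst_pair_pmf)

lemma integrable_pair_pmf_snd:
  fixes h :: "'b \<Rightarrow> real"
  assumes "integrable (measure_pmf q) h"
  shows "integrable (measure_pmf (pair_pmf p q)) (\<lambda>x. h (snd x))"
  using assms integrable_map_pmf_eq[of snd "pair_pmf p q" h] by (simp add: map_snd_pair_pmf)

lemma expectation_sum_list_replicate:
  fixes h :: "'a \<Rightarrow> real"
  assumes h: "integrable (measure_pmf p) h"
  shows "integrable (measure_pmf (replicate_pmf n p)) (\<lambda>xs. \<Sum>x\<leftarrow>xs. h x)
    \<and> measure_pmf.expectation (replicate_pmf n p) (\<lambda>xs. \<Sum>x\<leftarrow>xs. h x)
      = real n * measure_pmf.expectation p h"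
proof (induction n)
  case 0
  then show ?case by (simp add: integrable_measure_pmf_finite)
next
  case (Suc n)
  then show ?case
    unfolding replicate_pmf_Suc_pair
    using integrable_pair_pmf_fst[OF h, of "replicate_pmf n p"]
      integrable_pair_pmf_snd[of "replicate_pmf n p" "\<lambda>xs. \<Sum>x\<leftarrow>xs. h x" p]
      expectation_pair_pmf_fst[of p "replicate_pmf n p" h]
      expectation_pair_pmf_snd[of p "replicate_pmf n p" "\<lambda>xs. \<Sum>x\<leftarrow>xs. h x"]
    by (simp add: algebra_simps)
qed

text \<open>Symmetric summands are orthogonal: replacing the first sample \<open>x\<close> by \<open>\<sigma> x\<close> preserves the
  joint law and flips the sign of the cross term, so averaging the two squares removes it.\<close>

lemma second_moment_symmetric_sum:
  fixes h :: "'a \<Rightarrow> real"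
  assumes \<sigma>: "map_pmf \<sigma> p = p" and odd: "\<And>x. x \<in> set_pmf p \<Longrightarrow> h (\<sigma> x) = - h x"
    and h: "integrable (measure_pmf p) (\<lambda>x. (h x)\<^sup>2)"
  shows "integrable (measure_pmf (replicate_pmf n p)) (\<lambda>xs. (\<Sum>x\<leftarrow>xs. h x)\<^sup>2)
    \<and> measure_pmf.expectation (replicate_pmf n p) (\<lambda>xs. (\<Sum>x\<leftarrow>xs. h x)\<^sup>2)
      = real n * measure_pmf.expectation p (\<lambda>x. (h x)\<^sup>2)"
proof (induction n)
  case 0
  then show ?case by (simp add: integrable_measure_pmf_finite)
next
  case (Suc n)
  define Y where "Y xs = (\<Sum>x\<leftarrow>xs. h x)" for xs
  let ?Q = "pair_pmf p (replicate_pmf n p)"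
  let ?u = "\<lambda>x. (h (fst x) + Y (snd x))\<^sup>2" and ?v = "\<lambda>x. (- h (fst x) + Y (snd x))\<^sup>2"
  have Y: "integrable (measure_pmf (replicate_pmf n p)) (\<lambda>xs. (Y xs)\<^sup>2)"
    and EY: "measure_pmf.expectation (replicate_pmf n p) (\<lambda>xs. (Y xs)\<^sup>2)
      = real n * measure_pmf.expectation p (\<lambda>x. (h x)\<^sup>2)"
    using Suc by (auto simp: Y_def)
  have sq: "integrable ?Q (\<lambda>x. (h (fst x))\<^sup>2)" "integrable ?Q (\<lambda>x. (Y (snd x))\<^sup>2)"
    using integrable_pair_pmf_fst[OF h] integrable_pair_pmf_snd[OF Y] by auto
  then have dom: "integrable ?Q (\<lambda>x. 2 * (h (fst x))\<^sup>2 + 2 * (Y (snd x))\<^sup>2)"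
    by simp
  have two_squares: "(a + b)\<^sup>2 \<le> 2 * a\<^sup>2 + 2 * b\<^sup>2" for a b :: real
    using zero_le_power2[of "a - b"] by (simp add: power2_eq_square algebra_simps)
  have u: "integrable ?Q ?u"
    by (rule Bochner_Integration.integrable_bound[OF dom]) (auto simp: two_squares)
  have v: "integrable ?Q ?v"
    using two_squares[of "- h (fst x)" "Y (snd x)" for x]
    by (intro Bochner_Integration.integrable_bound[OF dom]) auto
  have "map_pmf (\<lambda>x. (\<sigma> (fst x), snd x)) ?Q = ?Q"
    using map_pair[of \<sigma> id p "replicate_pmf n p"] \<sigma> by (simp add: case_prod_unfold)
  then have "measure_pmf.expectation ?Q ?u
      = measure_pmf.expectation (map_pmf (\<lambda>x. (\<sigma> (fst x), snd x)) ?Q) ?u"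
    by simp
  also have "\<dots> = measure_pmf.expectation ?Q (\<lambda>x. (h (\<sigma> (fst x)) + Y (snd x))\<^sup>2)"
    by simp
  also have "\<dots> = measure_pmf.expectation ?Q ?v"
    by (intro integral_cong_AE) (auto simp: AE_measure_pmf_iff odd)
  finally have "2 * measure_pmf.expectation ?Q ?u
      = measure_pmf.expectation ?Q (\<lambda>x. ?u x + ?v x)"
    using u v by simp
  also have "\<dots> = measure_pmf.expectation ?Q (\<lambda>x. 2 * (h (fst x))\<^sup>2 + 2 * (Y (snd x))\<^sup>2)"
    by (intro Bochner_Integration.integral_cong) (auto simp: power2_eq_square algebra_simps)
  also have "\<dots> = 2 * measure_pmf.expectation p (\<lambda>x. (h x)\<^sup>2)
      + 2 * measure_pmf.expectation (replicate_pmf n p) (\<lambda>xs. (Y xs)\<^sup>2)"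
    using sq expectation_pair_pmf_fst[of p "replicate_pmf n p" "\<lambda>x. (h x)\<^sup>2"]
      expectation_pair_pmf_snd[of p "replicate_pmf n p" "\<lambda>x. (Y x)\<^sup>2"] by simp
  finally have "measure_pmf.expectation ?Q ?u = real (Suc n) * measure_pmf.expectation p (\<lambda>x. (h x)\<^sup>2)"
    unfolding EY by (simp add: algebra_simps)
  with u show ?case
    unfolding replicate_pmf_Suc_pair by (simp add: Y_def)
qed

lemma expectation_prod_list_replicate:
  fixes h :: "'a \<Rightarrow> real"
  assumes fin: "finite (set_pmf p)"
  shows "measure_pmf.expectation (replicate_pmf n p) (\<lambda>xs. \<Prod>x\<leftarrow>xs. h x)
    = measure_pmf.expectation p h ^ n"
proof (induction n)
  case 0
  then show ?case by simp
next
  case (Suc n)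
  have "finite {xs. set xs \<subseteq> set_pmf p \<and> length xs = n}"
    by (rule finite_lists_length_eq[OF fin])
  then have finr: "finite (set_pmf (replicate_pmf n p))"
    unfolding set_replicate_pmf by (rule rev_finite_subset) auto
  have "measure_pmf.expectation (replicate_pmf (Suc n) p) (\<lambda>xs. \<Prod>x\<leftarrow>xs. h x)
      = (\<Sum>a\<in>set_pmf p. pmf p a *\<^sub>R measure_pmf.expectation
          (map_pmf (\<lambda>xs. a # xs) (replicate_pmf n p)) (\<lambda>xs. \<Prod>x\<leftarrow>xs. h x))"
    unfolding replicate_pmf.simps(2) map_pmf_def[symmetric]
    by (rule pmf_expectation_bind[OF fin]) (use finr in auto)
  also have "\<dots> = (\<Sum>a\<in>set_pmf p. h a * pmf p a) * measure_pmf.expectation p h ^ n"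
    by (simp add: Suc sum_distrib_left sum_distrib_right mult_ac)
  also have "(\<Sum>a\<in>set_pmf p. h a * pmf p a) = measure_pmf.expectation p h"
    using integral_measure_pmf_real[OF fin, of p h] by simp
  finally show ?case by simp
qed

section \<open>The walk in the zero section\<close>

lemma carrier_zero_section: "g \<in> carrier zero_section \<longleftrightarrow> g \<in> carrier wreath_ZZ \<and> snd g = 0"
  by (cases g) (simp add: zero_section_def)

lemma one_zero_section: "\<one>\<^bsub>zero_section\<^esub> = \<one>\<^bsub>wreath_ZZ\<^esub>"
  by (simp add: zero_section_def)

lemma foldr_zero_section:
  assumes "set gs \<subseteq> carrier zero_section"
  shows "foldr (\<otimes>\<^bsub>zero_section\<^esub>) gs \<one>\<^bsub>zero_section\<^esub> = (\<lambda>z. \<Sum>g\<leftarrow>gs. fst g z, 0)"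
proof -
  have "(\<otimes>\<^bsub>zero_section\<^esub>) = (\<otimes>\<^bsub>wreath_ZZ\<^esub>)"
    by (simp add: zero_section_def)
  then show ?thesis
    using assms
    by (induction gs) (auto simp: one_zero_section one_wreath_ZZ mult_wreath_ZZ carrier_zero_section)
qed

lemma inv_zero_section:
  assumes "g \<in> carrier zero_section"
  shows "inv\<^bsub>zero_section\<^esub> g = wr_inv g"
proof -
  have "inv\<^bsub>wreath_ZZ\<lparr>carrier := carrier zero_section\<rparr>\<^esub> g = inv\<^bsub>wreath_ZZ\<^esub> g"
    using group.m_inv_consistent[OF group_wreath_ZZ subgroup_zero_section assms] by simp
  then show ?thesis
    using assms inv_wreath_ZZ[of g] by (auto simp: zero_section_def)
qed

lemma wr_inv_zero_section:
  "g \<in> carrier zero_section \<Longrightarrow> wr_inv g = (\<lambda>z. - fst g z, 0)"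
  by (auto simp: wr_inv_def carrier_zero_section)

lemma symmetric_pmf_zero_section:
  "symmetric_pmf zero_section \<mu> \<longleftrightarrow>
    set_pmf \<mu> \<subseteq> carrier zero_section \<and> map_pmf wr_inv \<mu> = \<mu>"
proof -
  have pmf_map: "pmf (map_pmf wr_inv \<mu>) g = pmf \<mu> (wr_inv g)" for g
    using pmf_map_inj'[OF inj_wr_inv, of \<mu> "wr_inv g"] by simp
  have closed: "wr_inv g \<in> carrier zero_section" if "g \<in> carrier zero_section" for g
    using group.inv_closed[OF group_zero_section that] inv_zero_section[OF that] by simp
  have "(\<forall>g\<in>carrier zero_section. pmf \<mu> g = pmf \<mu> (inv\<^bsub>zero_section\<^esub> g)) \<longleftrightarrow> map_pmf wr_inv \<mu> = \<mu>"
    if sub: "set_pmf \<mu> \<subseteq> carrier zero_section"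
  proof
    assume *: "\<forall>g\<in>carrier zero_section. pmf \<mu> g = pmf \<mu> (inv\<^bsub>zero_section\<^esub> g)"
    show "map_pmf wr_inv \<mu> = \<mu>"
    proof (rule pmf_eqI)
      fix g
      show "pmf (map_pmf wr_inv \<mu>) g = pmf \<mu> g"
      proof (cases "g \<in> carrier zero_section")
        case True
        then show ?thesis using * by (simp add: pmf_map inv_zero_section)
      next
        case False
        then have "g \<notin> set_pmf \<mu>" "wr_inv g \<notin> set_pmf \<mu>"
          using sub closed[of "wr_inv g"] by auto
        then show ?thesis by (simp add: pmf_map set_pmf_iff)
      qed
    qed
  next
    assume "map_pmf wr_inv \<mu> = \<mu>"
    then show "\<forall>g\<in>carrier zero_section. pmf \<mu> g = pmf \<mu> (inv\<^bsub>zero_section\<^esub> g)"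
      using pmf_map by (auto simp: inv_zero_section)
  qed
  then show ?thesis
    by (auto simp: symmetric_pmf_def)
qed

lemma set_walk_zero_section:
  assumes "set_pmf \<mu> \<subseteq> carrier zero_section" "gs \<in> set_pmf (replicate_pmf t \<mu>)"
  shows "set gs \<subseteq> carrier zero_section"
  using assms by (auto simp: set_replicate_pmf)

lemma expectation_walk:
  assumes "set_pmf \<mu> \<subseteq> carrier zero_section"
  shows "measure_pmf.expectation (walk zero_section \<mu> t)
      (\<lambda>x. word_metric wreath_ZZ wreath_ZZ_gens x \<one>\<^bsub>zero_section\<^esub>)
    = measure_pmf.expectation (replicate_pmf t \<mu>) (\<lambda>gs. real (wr_norm (\<lambda>z. \<Sum>g\<leftarrow>gs. fst g z, 0)))"
proof -
  have "word_metric wreath_ZZ wreath_ZZ_gens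
      (foldr (\<otimes>\<^bsub>zero_section\<^esub>) gs \<one>\<^bsub>zero_section\<^esub>) \<one>\<^bsub>zero_section\<^esub>
      = real (wr_norm (\<lambda>z. \<Sum>g\<leftarrow>gs. fst g z, 0))" if "gs \<in> set_pmf (replicate_pmf t \<mu>)" for gs
  proof -
    have gs: "set gs \<subseteq> carrier zero_section"
      by (rule set_walk_zero_section[OF assms that])
    then have "foldr (\<otimes>\<^bsub>zero_section\<^esub>) gs \<one>\<^bsub>zero_section\<^esub> \<in> carrier wreath_ZZ"
      using group.foldr_mult_closed[OF group_zero_section gs] by (simp add: carrier_zero_section)
    then show ?thesis
      unfolding one_zero_section
      by (subst word_metric_one) (use foldr_zero_section[OF gs] one_zero_section in simp_all)
  qed
  then show ?thesis
    unfolding walk_def by (auto intro!: integral_cong_AE simp: AE_measure_pmf_iff)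
qed

lemma expectation_walk_one:
  assumes "set_pmf \<mu> \<subseteq> carrier zero_section"
  shows "measure_pmf.expectation (walk zero_section \<mu> 1)
      (\<lambda>x. word_metric wreath_ZZ wreath_ZZ_gens x \<one>\<^bsub>zero_section\<^esub> powr p)
    = measure_pmf.expectation \<mu> (\<lambda>g. real (wr_norm g) powr p)"
proof -
  interpret group zero_section by (rule group_zero_section)
  have "walk zero_section \<mu> 1 = map_pmf (\<lambda>g. g) \<mu>"
    unfolding walk_def replicate_pmf_1 pmf.map_comp
    by (rule map_pmf_cong) (use assms in auto)
  then show ?thesis
    using assms
    by (auto intro!: integral_cong_AE
        simp: AE_measure_pmf_iff word_metric_one one_zero_section carrier_zero_section subset_iff)
qed

section \<open>The upper bound\<close>

text \<open>An increment whose norm exceeds \<open>R\<close> is replaced by the identity; the norm being invariant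
  under inversion, a symmetric law stays symmetric.\<close>

definition trunc :: "real \<Rightarrow> (int \<Rightarrow> int) \<times> int \<Rightarrow> int \<Rightarrow> int" where
  "trunc R g z = (if real (wr_norm g) \<le> R then fst g z else 0)"

lemma finite_support_sum_list:
  assumes "set gs \<subseteq> carrier zero_section" "finite {z. f z \<noteq> 0}"
  shows "finite {z. f z + (\<Sum>g\<leftarrow>gs. fst g z) \<noteq> 0}"
  using assms
proof (induction gs arbitrary: f)
  case (Cons g gs)
  have "finite {z. fst g z \<noteq> 0}"
    using Cons.prems by (simp add: carrier_zero_section carrier_wreath_ZZ)
  then have "finite {z. f z + fst g z \<noteq> 0}"
    by (rule rev_finite_subset[OF finite_UnI[OF Cons.prems(2)]]) auto
  then show ?case using Cons.IH[of "\<lambda>z. f z + fst g z"] Cons.prems by (simp add: add_ac)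
qed simp

text \<open>The zero section is abelian, so the large increments can be split off one at a time,
  each at the price of its own norm.\<close>

lemma wr_norm_split_large:
  assumes "set gs \<subseteq> carrier zero_section" "finite {z. f z \<noteq> 0}"
  shows "real (wr_norm (\<lambda>z. f z + (\<Sum>g\<leftarrow>gs. fst g z), 0))
    \<le> (\<Sum>g\<leftarrow>gs. if R < real (wr_norm g) then real (wr_norm g) else 0)
      + real (wr_norm (\<lambda>z. f z + (\<Sum>g\<leftarrow>gs. trunc R g z), 0))"
  using assms
proof (induction gs arbitrary: f)
  case (Cons g gs)
  have g: "g \<in> carrier wreath_ZZ" "snd g = 0" and gs: "set gs \<subseteq> carrier zero_section"
    using Cons.prems by (auto simp: carrier_zero_section)
  show ?case
  proof (cases "R < real (wr_norm g)")
    case True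
    let ?h = "(\<lambda>z. f z + (\<Sum>g\<leftarrow>gs. fst g z), 0::int)"
    have "?h \<in> carrier wreath_ZZ"
      using finite_support_sum_list[OF gs Cons.prems(2)] by (simp add: carrier_wreath_ZZ)
    moreover have "(\<lambda>z. f z + (\<Sum>g\<leftarrow>g # gs. fst g z), 0) = g \<otimes>\<^bsub>wreath_ZZ\<^esub> ?h"
      unfolding mult_wreath_ZZ g(2) by (simp add: algebra_simps)
    ultimately have "wr_norm (\<lambda>z. f z + (\<Sum>g\<leftarrow>g # gs. fst g z), 0) \<le> wr_norm g + wr_norm ?h"
      using wr_norm_mult_le[OF g(1)] by presburger
    moreover have "trunc R g z = 0" for z
      using True by (simp add: trunc_def)
    ultimately show ?thesis
      using Cons.IH[OF gs Cons.prems(2)] True by simp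
  next
    case False
    have "finite {z. f z + fst g z \<noteq> 0}"
      using finite_support_sum_list[of "[g]" f] Cons.prems by simp
    moreover have "trunc R g z = fst g z" for z
      using False by (simp add: trunc_def)
    ultimately show ?thesis
      using Cons.IH[OF gs, of "\<lambda>z. f z + fst g z"] False by (simp add: add.assoc)
  qed
qed simp

lemma sum_list_neq_0_imp:
  fixes h :: "'a \<Rightarrow> int"
  shows "(\<Sum>x\<leftarrow>xs. h x) \<noteq> 0 \<Longrightarrow> \<exists>x\<in>set xs. h x \<noteq> 0"
  by (induction xs) auto

text \<open>The truncated increments only change lamps in \<open>{- R..R}\<close>, so the tour through these lamps
  costs \<open>O(R)\<close>. The heights of the lamps are passed to second moments by
  \<open>\<bar>a\<bar> \<le> a\<^sup>2 / (2 * R) + R / 2\<close>: for the final choice of \<open>R\<close> the typical height is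
  \<open>R\<close>, where this inequality is sharp, so nothing is lost against Cauchy-Schwarz, and the bound
  stays linear in quantities whose expectations are known.\<close>

lemma wr_norm_walk_le:
  assumes gs: "set gs \<subseteq> carrier zero_section" and R: "1 \<le> R"
  shows "real (wr_norm (\<lambda>z. \<Sum>g\<leftarrow>gs. fst g z, 0))
    \<le> (\<Sum>g\<leftarrow>gs. if R < real (wr_norm g) then real (wr_norm g) else 0)
      + (\<Sum>z=-\<lfloor>R\<rfloor>..\<lfloor>R\<rfloor>. (\<Sum>g\<leftarrow>gs. real_of_int (trunc R g z))\<^sup>2) / (2 * R) + 15 / 2 * R\<^sup>2"
proof -
  define s where "s z = (\<Sum>g\<leftarrow>gs. trunc R g z)" for z
  define n where "n = nat \<lfloor>R\<rfloor>"
  have n: "int n = \<lfloor>R\<rfloor>" using R by (simp add: n_def)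
  have supp: "\<bar>z\<bar> \<le> int n" if "s z \<noteq> 0" for z
  proof -
    obtain g where g: "g \<in> set gs" "trunc R g z \<noteq> 0"
      using sum_list_neq_0_imp[of "\<lambda>g. trunc R g z" gs] \<open>s z \<noteq> 0\<close>
      unfolding s_def by blast
    then have "\<bar>z\<bar> \<le> int (wr_norm g)" "real (wr_norm g) \<le> R"
      using gs support_le_wr_norm[of g z] by (auto simp: trunc_def carrier_zero_section split: if_splits)
    then show ?thesis unfolding n by linarith
  qed
  have of_s: "real_of_int (s z) = (\<Sum>g\<leftarrow>gs. real_of_int (trunc R g z))" for z
    unfolding s_def by (induction gs) auto
  have abs_le: "real_of_int \<bar>a\<bar> \<le> (real_of_int a)\<^sup>2 / (2 * R) + R / 2" for a
  proof -
    have "0 \<le> (real_of_int \<bar>a\<bar> - R)\<^sup>2" by simp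
    then have "2 * R * real_of_int \<bar>a\<bar> \<le> (real_of_int a)\<^sup>2 + R\<^sup>2"
      by (simp add: power2_diff algebra_simps)
    then show ?thesis using R by (simp add: field_simps power2_eq_square)
  qed
  have "real (wr_norm (s, 0)) = of_int (int (wr_norm (s, 0)))" by simp
  also have "\<dots> \<le> real_of_int ((\<Sum>z=-int n..int n. \<bar>s z\<bar>) + 4 * int n + 2)"
    using wr_norm_le_sum_abs[OF supp] by (simp only: of_int_le_iff)
  also have "\<dots> = (\<Sum>z=-\<lfloor>R\<rfloor>..\<lfloor>R\<rfloor>. real_of_int \<bar>s z\<bar>) + 4 * of_int \<lfloor>R\<rfloor> + 2"
    unfolding n by simp
  also have "(\<Sum>z=-\<lfloor>R\<rfloor>..\<lfloor>R\<rfloor>. real_of_int \<bar>s z\<bar>)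
      \<le> (\<Sum>z=-\<lfloor>R\<rfloor>..\<lfloor>R\<rfloor>. (real_of_int (s z))\<^sup>2 / (2 * R) + R / 2)"
    by (intro sum_mono abs_le)
  also have "\<dots> = (\<Sum>z=-\<lfloor>R\<rfloor>..\<lfloor>R\<rfloor>. (real_of_int (s z))\<^sup>2) / (2 * R) + (2 * of_int \<lfloor>R\<rfloor> + 1) * (R / 2)"
    using R by (simp add: sum.distrib sum_divide_distrib of_nat_nat)
  finally have "real (wr_norm (s, 0)) \<le> (\<Sum>z=-\<lfloor>R\<rfloor>..\<lfloor>R\<rfloor>. (real_of_int (s z))\<^sup>2) / (2 * R)
      + ((2 * of_int \<lfloor>R\<rfloor> + 1) * (R / 2) + 4 * of_int \<lfloor>R\<rfloor> + 2)"
    by simp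
  also have "(2 * of_int \<lfloor>R\<rfloor> + 1) * (R / 2) + 4 * of_int \<lfloor>R\<rfloor> + 2 \<le> 15 / 2 * R\<^sup>2"
  proof -
    have fl: "real_of_int \<lfloor>R\<rfloor> \<le> R" by simp
    have RR: "R \<le> R\<^sup>2" "1 \<le> R\<^sup>2" using R self_le_power[of R 2] by simp_all
    have "(2 * of_int \<lfloor>R\<rfloor> + 1) * (R / 2) \<le> (3 * R) * (R / 2)"
      by (intro mult_right_mono) (use R fl in linarith)+
    then have "(2 * of_int \<lfloor>R\<rfloor> + 1) * (R / 2) \<le> 3 / 2 * R\<^sup>2"
      by (simp add: power2_eq_square)
    then show ?thesis using fl RR by linarith
  qed
  finally have "real (wr_norm (s, 0))
      \<le> (\<Sum>z=-\<lfloor>R\<rfloor>..\<lfloor>R\<rfloor>. (\<Sum>g\<leftarrow>gs. real_of_int (trunc R g z))\<^sup>2) / (2 * R) + 15 / 2 * R\<^sup>2"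
    by (simp add: of_s)
  moreover have "real (wr_norm (\<lambda>z. \<Sum>g\<leftarrow>gs. fst g z, 0))
    \<le> (\<Sum>g\<leftarrow>gs. if R < real (wr_norm g) then real (wr_norm g) else 0) + real (wr_norm (s, 0))"
    using wr_norm_split_large[OF gs, of "\<lambda>_. 0" R] by (simp add: s_def[abs_def])
  ultimately show ?thesis by linarith
qed

text \<open>The next two lemmas interpolate towards the \<open>p\<close>-th moment: small increments are measured
  by their square, large ones by their first power.\<close>

lemma sum_trunc_squares_le:
  assumes "g \<in> carrier wreath_ZZ" "p \<le> 2" "0 < R"
  shows "(\<Sum>z\<in>A. (real_of_int (trunc R g z))\<^sup>2) \<le> R powr (2 - p) * real (wr_norm g) powr p"
proof (cases "real (wr_norm g) \<le> R \<and> finite A")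
  case True
  define N where "N = real (wr_norm g)"
  have sum: "(\<Sum>z\<in>A. real_of_int \<bar>fst g z\<bar>) \<le> N"
    using sum_abs_le_wr_norm[OF assms(1), of A] True
    by (simp add: N_def flip: of_int_abs of_int_sum)
  have each: "real_of_int \<bar>fst g z\<bar> \<le> N" for z
    using sum_abs_le_wr_norm[OF assms(1), of "{z}"] by (simp add: N_def)
  have "(\<Sum>z\<in>A. (real_of_int (trunc R g z))\<^sup>2) = (\<Sum>z\<in>A. real_of_int \<bar>fst g z\<bar> * real_of_int \<bar>fst g z\<bar>)"
    using True by (simp add: trunc_def power2_eq_square flip: abs_mult)
  also have "\<dots> \<le> (\<Sum>z\<in>A. N * real_of_int \<bar>fst g z\<bar>)"
    by (intro sum_mono mult_right_mono each) simp
  also have "\<dots> \<le> N * N"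
    unfolding sum_distrib_left[symmetric] by (intro mult_left_mono sum) (simp add: N_def)
  also have "\<dots> \<le> R powr (2 - p) * N powr p"
  proof (cases "N = 0")
    case False
    then have N: "0 < N" by (simp add: N_def)
    then have "N * N = N powr (2 - p) * N powr p"
      by (simp add: power2_eq_square flip: powr_add)
    also have "\<dots> \<le> R powr (2 - p) * N powr p"
      using True N assms by (intro mult_right_mono powr_mono2) (auto simp: N_def)
    finally show ?thesis .
  qed simp
  finally show ?thesis by (simp add: N_def)
next
  case False
  then show ?thesis by (auto simp: trunc_def)
qed

lemma large_le_powr:
  fixes N :: real
  assumes "1 \<le> p" "0 < R"
  shows "(if R < N then N else 0) \<le> R powr (1 - p) * N powr p"
proof (cases "R < N")
  case True
  have "N = N powr (1 - p) * N powr p"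
    using True assms by (simp flip: powr_add)
  also have "\<dots> \<le> R powr (1 - p) * N powr p"
    using True assms by (intro mult_right_mono powr_mono2') auto
  finally show ?thesis using True by simp
qed simp

text \<open>The increments of norm above \<open>R\<close> contribute at most their expected total norm. The others
  form a symmetric walk on the lamps of \<open>{- R..R}\<close>, whose second moment grows linearly in time;
  expectations are compared through the pointwise bound above.\<close>

lemma expectation_norm_le_truncation:
  assumes sub: "set_pmf \<mu> \<subseteq> carrier zero_section" and sym: "map_pmf wr_inv \<mu> = \<mu>"
    and int: "integrable (measure_pmf \<mu>) (\<lambda>g. real (wr_norm g) powr p)"
    and p: "1 \<le> p" "p \<le> 2" and R: "1 \<le> R"
  shows "measure_pmf.expectation (replicate_pmf t \<mu>) (\<lambda>gs. real (wr_norm (\<lambda>z. \<Sum>g\<leftarrow>gs. fst g z, 0)))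
    \<le> 3 / 2 * R powr (1 - p) * (real t * measure_pmf.expectation \<mu> (\<lambda>g. real (wr_norm g) powr p))
      + 15 / 2 * R\<^sup>2"
proof -
  let ?E = "measure_pmf.expectation (replicate_pmf t \<mu>)"
  let ?m = "measure_pmf.expectation \<mu> (\<lambda>g. real (wr_norm g) powr p)"
  let ?l = "\<lambda>g. R powr (1 - p) * real (wr_norm g) powr p"
  let ?q = "\<lambda>z g. real_of_int (trunc R g z)"
  let ?J = "{-\<lfloor>R\<rfloor>..\<lfloor>R\<rfloor>}"
  have wr: "g \<in> carrier wreath_ZZ" "snd g = 0" if "g \<in> set_pmf \<mu>" for g
    using that sub by (auto simp: carrier_zero_section)
  have q2: "(?q z g)\<^sup>2 \<le> R powr (2 - p) * real (wr_norm g) powr p" if "g \<in> set_pmf \<mu>" for g z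
    using sum_trunc_squares_le[OF wr(1)[OF that] p(2), of R "{z}"] R by simp
  have int_q2: "integrable (measure_pmf \<mu>) (\<lambda>g. (?q z g)\<^sup>2)" for z
    by (rule Bochner_Integration.integrable_bound[OF integrable_mult_right[OF int, of "R powr (2 - p)"]])
      (auto simp: AE_measure_pmf_iff q2)
  have odd: "?q z (wr_inv g) = - ?q z g" if "g \<in> set_pmf \<mu>" for z g
    using wr[OF that] by (simp add: trunc_def wr_norm_wr_inv) (simp add: wr_inv_def)
  have second: "integrable (replicate_pmf t \<mu>) (\<lambda>gs. (\<Sum>g\<leftarrow>gs. ?q z g)\<^sup>2)"
    "?E (\<lambda>gs. (\<Sum>g\<leftarrow>gs. ?q z g)\<^sup>2) = real t * measure_pmf.expectation \<mu> (\<lambda>g. (?q z g)\<^sup>2)" for z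
    using second_moment_symmetric_sum[of wr_inv \<mu> "?q z", OF sym odd int_q2, of t] by auto
  have int_l: "integrable (measure_pmf \<mu>) ?l" using int by simp
  note first = expectation_sum_list_replicate[OF int_l, of t]
  have le: "real (wr_norm (\<lambda>z. \<Sum>g\<leftarrow>gs. fst g z, 0))
      \<le> (\<Sum>g\<leftarrow>gs. ?l g) + (\<Sum>z\<in>?J. (\<Sum>g\<leftarrow>gs. ?q z g)\<^sup>2) / (2 * R) + 15 / 2 * R\<^sup>2"
    if "gs \<in> set_pmf (replicate_pmf t \<mu>)" for gs
  proof -
    have "(\<Sum>g\<leftarrow>gs. if R < real (wr_norm g) then real (wr_norm g) else 0) \<le> (\<Sum>g\<leftarrow>gs. ?l g)"
      using R p by (intro sum_list_mono large_le_powr) auto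
    then show ?thesis
      using wr_norm_walk_le[OF set_walk_zero_section[OF sub that] R] by linarith
  qed
  have int_rhs: "integrable (replicate_pmf t \<mu>)
      (\<lambda>gs. (\<Sum>g\<leftarrow>gs. ?l g) + (\<Sum>z\<in>?J. (\<Sum>g\<leftarrow>gs. ?q z g)\<^sup>2) / (2 * R) + 15 / 2 * R\<^sup>2)"
    using first second by (intro Bochner_Integration.integrable_add integrable_divide
      Bochner_Integration.integrable_sum) auto
  have rhs_nonneg: "0 \<le> (\<Sum>g\<leftarrow>gs. ?l g) + (\<Sum>z\<in>?J. (\<Sum>g\<leftarrow>gs. ?q z g)\<^sup>2) / (2 * R) + 15 / 2 * R\<^sup>2" for gs
    using R by (intro add_nonneg_nonneg sum_list_nonneg divide_nonneg_nonneg sum_nonneg) auto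
  have "?E (\<lambda>gs. real (wr_norm (\<lambda>z. \<Sum>g\<leftarrow>gs. fst g z, 0)))
      \<le> ?E (\<lambda>gs. (\<Sum>g\<leftarrow>gs. ?l g) + (\<Sum>z\<in>?J. (\<Sum>g\<leftarrow>gs. ?q z g)\<^sup>2) / (2 * R) + 15 / 2 * R\<^sup>2)"
    by (rule integral_mono_AE'[OF int_rhs]) (use le rhs_nonneg in \<open>simp_all add: AE_measure_pmf_iff\<close>)
  also have "\<dots> = real t * (R powr (1 - p) * ?m)
      + (\<Sum>z\<in>?J. real t * measure_pmf.expectation \<mu> (\<lambda>g. (?q z g)\<^sup>2)) / (2 * R) + 15 / 2 * R\<^sup>2"
    using first second by simp
  also have "(\<Sum>z\<in>?J. real t * measure_pmf.expectation \<mu> (\<lambda>g. (?q z g)\<^sup>2))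
      = real t * measure_pmf.expectation \<mu> (\<lambda>g. \<Sum>z\<in>?J. (?q z g)\<^sup>2)"
    using int_q2 by (simp add: sum_distrib_left)
  also have "\<dots> \<le> real t * measure_pmf.expectation \<mu> (\<lambda>g. R powr (2 - p) * real (wr_norm g) powr p)"
    using int int_q2 R p wr
    by (intro mult_left_mono integral_mono_AE)
      (auto simp: AE_measure_pmf_iff intro!: sum_trunc_squares_le)
  also have "\<dots> = real t * (R powr (2 - p) * ?m)" by simp
  also have "real t * (R powr (2 - p) * ?m) / (2 * R) = real t * ?m * R powr (1 - p) / 2"
  proof -
    have "R powr (2 - p) = R powr (1 - p) * R"
      using R powr_add[of R "1 - p" 1] by simp
    then show ?thesis using R by simp
  qed
  finally show ?thesis using R by (simp add: divide_right_mono algebra_simps)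
qed

text \<open>With \<open>R = S powr (1 / (p + 1))\<close> the terms \<open>R powr (1 - p) * S\<close> and \<open>R\<^sup>2\<close> coincide,
  both being \<open>S powr (2 / (p + 1))\<close>.\<close>

lemma expectation_norm_le:
  assumes "set_pmf \<mu> \<subseteq> carrier zero_section" "map_pmf wr_inv \<mu> = \<mu>"
    and "integrable (measure_pmf \<mu>) (\<lambda>g. real (wr_norm g) powr p)" and p: "1 \<le> p" "p \<le> 2"
    and S: "S = real t * measure_pmf.expectation \<mu> (\<lambda>g. real (wr_norm g) powr p)" "1 \<le> S"
  shows "measure_pmf.expectation (replicate_pmf t \<mu>) (\<lambda>gs. real (wr_norm (\<lambda>z. \<Sum>g\<leftarrow>gs. fst g z, 0)))
    \<le> 9 * S powr (2 / (p + 1))"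
proof -
  define R where "R = S powr (1 / (p + 1))"
  have R: "1 \<le> R" unfolding R_def using S(2) p by (simp add: ge_one_powr_ge_zero)
  have "R powr (1 - p) * S = S powr ((1 - p) / (p + 1)) * S powr 1"
    using S(2) by (simp add: R_def powr_powr)
  also have "\<dots> = S powr (2 / (p + 1))"
    using p by (simp only: powr_add[symmetric]) (simp add: field_simps)
  finally have 1: "R powr (1 - p) * S = S powr (2 / (p + 1))" .
  have "R\<^sup>2 = R powr 2" using R by simp
  then have 2: "R\<^sup>2 = S powr (2 / (p + 1))"
    by (simp add: R_def powr_powr)
  show ?thesis
    using expectation_norm_le_truncation[OF assms(1-5) R, of t] 1 2 unfolding S(1)[symmetric]
    by (simp add: mult.assoc)
qed

section \<open>A sequence attaining the bound\<close>

text \<open>The extremal law at time \<open>t\<close> makes the upper bound tight up to constants: increments have norm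
  comparable to \<open>R = t\<close>, each is concentrated on a single lamp, and the lamps are spread over a
  window of length \<open>t\<close>, so that within \<open>t\<close> steps each lamp is changed about once. The moment
  \<open>t * t powr p\<close> is thus \<open>R powr (p + 1)\<close> while the walk reaches norm \<open>R\<^sup>2\<close>.\<close>

definition lamp :: "nat \<Rightarrow> int \<times> int \<Rightarrow> (int \<Rightarrow> int) \<times> int" where
  "lamp t x = (\<lambda>z. if z = fst x then snd x * int t else 0, 0)"

definition spread_pmf :: "nat \<Rightarrow> ((int \<Rightarrow> int) \<times> int) pmf" where
  "spread_pmf t = map_pmf (lamp t) (pmf_of_set ({0..<int t} \<times> {- 1, 1}))"

lemma set_spread_pmf:
  assumes "1 \<le> t"
  shows "set_pmf (spread_pmf t) = lamp t ` ({0..<int t} \<times> {- 1, 1})"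
  using assms by (simp add: spread_pmf_def set_pmf_of_set)

lemma lamp_in_zero_section: "lamp t x \<in> carrier zero_section"
proof -
  have "{z. fst (lamp t x) z \<noteq> 0} \<subseteq> {fst x}"
    by (auto simp: lamp_def)
  then show ?thesis
    using finite_subset[of _ "{fst x}"] by (simp add: carrier_zero_section carrier_wreath_ZZ lamp_def)
qed

lemma set_spread_pmf_carrier: "1 \<le> t \<Longrightarrow> set_pmf (spread_pmf t) \<subseteq> carrier zero_section"
  by (auto simp: set_spread_pmf lamp_in_zero_section)

lemma spread_pmf_symmetric:
  assumes "1 \<le> t"
  shows "map_pmf wr_inv (spread_pmf t) = spread_pmf t"
proof -
  let ?A = "{0..<int t} \<times> {- 1, 1 :: int}" and ?\<tau> = "\<lambda>x. (fst x, - snd x) :: int \<times> int"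
  have "?\<tau> ` ?A = ?A"
    by (auto simp: image_iff)
  moreover have "inj_on ?\<tau> ?A"
    by (auto simp: inj_on_def)
  ultimately have "map_pmf ?\<tau> (pmf_of_set ?A) = pmf_of_set ?A"
    using assms map_pmf_of_set_inj[of ?\<tau> ?A] by simp
  moreover have "wr_inv \<circ> lamp t = lamp t \<circ> ?\<tau>"
    by (auto simp: wr_inv_def lamp_def fun_eq_iff)
  ultimately show ?thesis
    unfolding spread_pmf_def by (simp add: pmf.map_comp flip: pmf.map_comp[of "lamp t" ?\<tau>])
qed

lemma spread_pmf_norm:
  assumes "1 \<le> t" "g \<in> set_pmf (spread_pmf t)"
  shows "t \<le> wr_norm g" "wr_norm g \<le> 7 * t"
proof -
  obtain k s where g: "g = lamp t (k, s)" and k: "0 \<le> k" "k < int t" and s: "s = - 1 \<or> s = 1"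
    using assms by (auto simp: set_spread_pmf)
  have "(\<Sum>z\<in>{k}. \<bar>fst g z\<bar>) \<le> int (wr_norm g)"
    using lamp_in_zero_section by (intro sum_abs_le_wr_norm) (auto simp: g carrier_zero_section)
  then show "t \<le> wr_norm g"
    using s by (auto simp: g lamp_def)
  have "int (wr_norm (fst g, 0)) \<le> (\<Sum>z=-int t..int t. \<bar>fst g z\<bar>) + 4 * int t + 2"
    using k by (intro wr_norm_le_sum_abs) (auto simp: g lamp_def split: if_splits)
  also have "(\<Sum>z=-int t..int t. \<bar>fst g z\<bar>) = (\<Sum>z=-int t..int t. if z = k then int t else 0)"
    using s by (intro sum.cong) (auto simp: g lamp_def)
  also have "\<dots> = int t"
    using k by simp
  finally show "wr_norm g \<le> 7 * t"
    using assms(1) by (simp add: g lamp_def)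
qed

lemma expectation_spread_pmf_powr:
  assumes "1 \<le> t" "0 \<le> p"
  shows "integrable (measure_pmf (spread_pmf t)) (\<lambda>g. real (wr_norm g) powr p)"
    and "real t powr p \<le> measure_pmf.expectation (spread_pmf t) (\<lambda>g. real (wr_norm g) powr p)"
    and "measure_pmf.expectation (spread_pmf t) (\<lambda>g. real (wr_norm g) powr p) \<le> (7 * real t) powr p"
proof -
  show int: "integrable (measure_pmf (spread_pmf t)) (\<lambda>g. real (wr_norm g) powr p)"
    by (rule integrable_measure_pmf_finite) (use assms in \<open>simp add: set_spread_pmf\<close>)
  have *: "real t \<le> real (wr_norm g)" "real (wr_norm g) \<le> 7 * real t"
    if "g \<in> set_pmf (spread_pmf t)" for g
    using spread_pmf_norm[OF assms(1) that] by linarith+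
  show "real t powr p \<le> measure_pmf.expectation (spread_pmf t) (\<lambda>g. real (wr_norm g) powr p)"
    using * assms by (intro measure_pmf.integral_ge_const int) (auto simp: AE_measure_pmf_iff intro!: powr_mono2)
  show "measure_pmf.expectation (spread_pmf t) (\<lambda>g. real (wr_norm g) powr p) \<le> (7 * real t) powr p"
    using * assms by (intro measure_pmf.integral_le_const int) (auto simp: AE_measure_pmf_iff intro!: powr_mono2)
qed

lemma expectation_cos_spread_pmf:
  assumes "1 \<le> t" "0 \<le> z" "z < int t"
  shows "measure_pmf.expectation (spread_pmf t) (\<lambda>g. cos (pi * (real_of_int (fst g z) / real t)))
    = 1 - 2 / real t"
proof -
  let ?c = "\<lambda>x. cos (pi * (real_of_int (fst (lamp t x) z) / real t))"
  have c: "?c (k, s) = (if k = z then - 1 else 1)" if "s \<in> {- 1, 1}" for k s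
    using that assms(1) by (auto simp: lamp_def)
  have "(\<Sum>x\<in>{0..<int t} \<times> {- 1, 1}. ?c x) = (\<Sum>k\<in>{0..<int t}. \<Sum>s\<in>{- 1, 1}. ?c (k, s))"
    by (subst sum.cartesian_product) (simp add: case_prod_unfold)
  also have "\<dots> = (\<Sum>k\<in>{0..<int t}. \<Sum>s\<in>{- 1, 1 :: int}. if k = z then - 1 else 1)"
    by (intro sum.cong refl c)
  also have "\<dots> = (\<Sum>k\<in>{0..<int t}. 2 - 4 * (if k = z then 1 else 0))"
    by (intro sum.cong refl) simp
  also have "\<dots> = 2 * real t - 4"
    using assms by (subst sum_subtractf) (simp flip: sum_distrib_left)
  finally have "(\<Sum>x\<in>{0..<int t} \<times> {- 1, 1}. ?c x) = 2 * real t - 4" .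
  then show ?thesis
    using assms unfolding spread_pmf_def integral_map_pmf
    by (subst integral_pmf_of_set) (auto simp: field_simps)
qed

text \<open>All entries are multiples of \<open>t\<close>, on which \<open>\<lambda>x. cos (pi * x / t)\<close> is a multiplicative
  character with values in \<open>{- 1, 1}\<close>: it records the parity of \<open>x / t\<close>, and an odd multiple
  of \<open>t\<close> has absolute value at least \<open>t\<close>. Since characters turn the sum into a product, the
  expectation of the left-hand side can be computed exactly.\<close>

lemma abs_sum_list_ge_parity:
  assumes t: "1 \<le> t" and gs: "set gs \<subseteq> set_pmf (spread_pmf t)"
  shows "real t * (1 - (\<Prod>g\<leftarrow>gs. cos (pi * (real_of_int (fst g z) / real t)))) / 2
    \<le> real_of_int \<bar>\<Sum>g\<leftarrow>gs. fst g z\<bar>"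
proof -
  define x where "x = (\<Sum>g\<leftarrow>gs. fst g z)"
  have dvd: "int t dvd fst g z" if "g \<in> set gs" for g
    using that gs t by (auto simp: set_spread_pmf lamp_def)
  then have "int t dvd x"
    unfolding x_def by (induction gs) auto
  have "cos (pi * (real_of_int (\<Sum>g\<leftarrow>gs. fst g z) / real t))
      = (\<Prod>g\<leftarrow>gs. cos (pi * (real_of_int (fst g z) / real t)))"
    using dvd
  proof (induction gs)
    case (Cons g gs)
    obtain k where "fst g z = int t * k"
      using Cons.prems[of g] by (auto elim: dvdE)
    then have "sin (pi * (real_of_int (fst g z) / real t)) = 0"
      using t by (simp add: sin_zero_iff_int2)
    then show ?case
      using Cons by (simp add: add_divide_distrib distrib_left cos_add)
  qed simp
  then have cos: "(\<Prod>g\<leftarrow>gs. cos (pi * (real_of_int (fst g z) / real t)))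
      = cos (pi * (real_of_int x / real t))"
    by (simp add: x_def)
  show ?thesis
  proof (cases "x = 0")
    case True
    then show ?thesis unfolding cos x_def[symmetric] by simp
  next
    case False
    then have "int t \<le> \<bar>x\<bar>"
      using \<open>int t dvd x\<close> dvd_imp_le_int by force
    then have "real t \<le> real_of_int \<bar>x\<bar>" by linarith
    moreover have "real t * (1 - cos (pi * (real_of_int x / real t))) \<le> real t * 2"
      using cos_ge_minus_one[of "pi * (real_of_int x / real t)"] by (intro mult_left_mono) auto
    ultimately show ?thesis unfolding cos x_def[symmetric] by linarith
  qed
qed

text \<open>The parity character of each of the \<open>t\<close> lamps has mean \<open>(1 - 2 / t) ^ t \<le> exp (- 2)\<close>, so
  every lamp is at an odd multiple of \<open>t\<close> with probability bounded below.\<close>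

lemma expectation_norm_spread_pmf_ge:
  assumes "2 \<le> t"
  shows "(real t)\<^sup>2 / 4 \<le> measure_pmf.expectation (replicate_pmf t (spread_pmf t))
    (\<lambda>gs. real (wr_norm (\<lambda>z. \<Sum>g\<leftarrow>gs. fst g z, 0)))"
proof -
  let ?r = "replicate_pmf t (spread_pmf t)"
  let ?c = "\<lambda>z g. cos (pi * (real_of_int (fst g z) / real t))"
  have t: "1 \<le> t" using assms by simp
  have fin: "finite (set_pmf (spread_pmf t))" using t by (simp add: set_spread_pmf)
  have "finite {gs. set gs \<subseteq> set_pmf (spread_pmf t) \<and> length gs = t}"
    by (rule finite_lists_length_eq[OF fin])
  then have finr: "finite (set_pmf ?r)"
    unfolding set_replicate_pmf by (rule rev_finite_subset) auto
  note int = integrable_measure_pmf_finite[OF finr]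
  have le: "(\<Sum>z\<in>{0..<int t}. real t * (1 - (\<Prod>g\<leftarrow>gs. ?c z g)) / 2)
      \<le> real (wr_norm (\<lambda>z. \<Sum>g\<leftarrow>gs. fst g z, 0))" if "gs \<in> set_pmf ?r" for gs
  proof -
    have gs: "set gs \<subseteq> set_pmf (spread_pmf t)"
      using that by (auto simp: set_replicate_pmf)
    then have "set gs \<subseteq> carrier zero_section"
      using set_spread_pmf_carrier[OF t] by auto
    then have "(\<lambda>z. \<Sum>g\<leftarrow>gs. fst g z, 0) \<in> carrier wreath_ZZ"
      using finite_support_sum_list[of gs "\<lambda>_. 0"] by (simp add: carrier_wreath_ZZ)
    from sum_abs_le_wr_norm[OF this, of "{0..<int t}"]
    have "real_of_int (\<Sum>z\<in>{0..<int t}. \<bar>\<Sum>g\<leftarrow>gs. fst g z\<bar>)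
        \<le> real_of_int (int (wr_norm (\<lambda>z. \<Sum>g\<leftarrow>gs. fst g z, 0)))"
      unfolding of_int_le_iff by simp
    moreover have "(\<Sum>z\<in>{0..<int t}. real t * (1 - (\<Prod>g\<leftarrow>gs. ?c z g)) / 2)
        \<le> (\<Sum>z\<in>{0..<int t}. real_of_int \<bar>\<Sum>g\<leftarrow>gs. fst g z\<bar>)"
      by (intro sum_mono abs_sum_list_ge_parity t gs)
    ultimately show ?thesis by simp
  qed
  have "(1 - 2 / real t) ^ t \<le> exp (- 2)"
    using assms by (intro exp_ge_one_minus_x_over_n_power_n) auto
  also have "exp (- 2) \<le> (1 / 2 :: real)"
    using exp_ge_add_one_self[of "2::real"] by (simp add: exp_minus field_simps)
  finally have half: "1 / 2 \<le> 1 - (1 - 2 / real t) ^ t" by simp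
  have "(real t)\<^sup>2 / 4 = real t * (real t * (1 / 2) / 2)"
    by (simp add: power2_eq_square)
  also have "\<dots> \<le> real t * (real t * (1 - (1 - 2 / real t) ^ t) / 2)"
    by (intro mult_left_mono divide_right_mono half) auto
  also have "\<dots> = (\<Sum>z\<in>{0..<int t}. real t * (1 - (1 - 2 / real t) ^ t) / 2)"
    by simp
  also have "\<dots> = (\<Sum>z\<in>{0..<int t}. measure_pmf.expectation ?r
      (\<lambda>gs. real t * (1 - (\<Prod>g\<leftarrow>gs. ?c z g)) / 2))"
  proof (intro sum.cong refl)
    fix z assume "z \<in> {0..<int t}"
    then have "measure_pmf.expectation ?r (\<lambda>gs. \<Prod>g\<leftarrow>gs. ?c z g) = (1 - 2 / real t) ^ t"
      using expectation_cos_spread_pmf[OF t] by (simp only: expectation_prod_list_replicate[OF fin]) simp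
    moreover have "measure_pmf.expectation ?r (\<lambda>_. 1 :: real) = 1" by simp
    ultimately have "measure_pmf.expectation ?r (\<lambda>gs. 1 - (\<Prod>g\<leftarrow>gs. ?c z g)) = 1 - (1 - 2 / real t) ^ t"
      by (subst Bochner_Integration.integral_diff[OF int int]) (simp only:)
    then show "real t * (1 - (1 - 2 / real t) ^ t) / 2 = measure_pmf.expectation ?r
        (\<lambda>gs. real t * (1 - (\<Prod>g\<leftarrow>gs. ?c z g)) / 2)"
      by (simp only: integral_divide_zero integral_mult_right_zero)
  qed
  also have "\<dots> = measure_pmf.expectation ?r
      (\<lambda>gs. \<Sum>z\<in>{0..<int t}. real t * (1 - (\<Prod>g\<leftarrow>gs. ?c z g)) / 2)"
    by (rule Bochner_Integration.integral_sum[symmetric]) (rule int)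
  also have "\<dots> \<le> measure_pmf.expectation ?r (\<lambda>gs. real (wr_norm (\<lambda>z. \<Sum>g\<leftarrow>gs. fst g z, 0)))"
    by (intro integral_mono_AE int) (use le in \<open>simp add: AE_measure_pmf_iff\<close>)
  finally show ?thesis .
qed

section \<open>The exponent\<close>

lemma ratio_of_affine_tendsto:
  fixes a b c d :: real
  assumes "filterlim L at_top F" "c \<noteq> 0"
  shows "((\<lambda>x. (a * L x + b) / (c * L x + d)) \<longlongrightarrow> a / c) F"
proof -
  have inv: "((\<lambda>x. e / L x) \<longlongrightarrow> 0) F" for e
    by (rule real_tendsto_divide_at_top[OF tendsto_const assms(1)])
  have "((\<lambda>x. (a + b / L x) / (c + d / L x)) \<longlongrightarrow> (a + 0) / (c + 0)) F"
    using assms(2) by (intro tendsto_intros inv) auto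
  moreover have "\<forall>\<^sub>F x in F. (a + b / L x) / (c + d / L x) = (a * L x + b) / (c * L x + d)"
    using filterlim_at_top_dense[THEN iffD1, OF assms(1), rule_format, of 0]
  proof eventually_elim
    case (elim x)
    then have "a + b / L x = (a * L x + b) / L x" "c + d / L x = (c * L x + d) / L x"
      by (simp_all add: field_simps)
    then show ?case using elim by simp
  qed
  ultimately show ?thesis
    by (simp add: filterlim_cong[OF refl refl])
qed

abbreviation "zs_metric \<equiv> word_metric wreath_ZZ wreath_ZZ_gens"

lemma beta_star_seq_le:
  assumes adm: "\<mu> \<in> admissible_walks zero_section zs_metric p" and p: "1 \<le> p" "p \<le> 2"
  shows "beta_star_seq zero_section zs_metric p \<mu> \<le> ereal (2 / (p + 1))"
proof -
  define S where "S t = real t * measure_pmf.expectation (\<mu> t) (\<lambda>g. real (wr_norm g) powr p)" for t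
  define e where "e t = measure_pmf.expectation (replicate_pmf t (\<mu> t))
    (\<lambda>gs. real (wr_norm (\<lambda>z. \<Sum>g\<leftarrow>gs. fst g z, 0)))" for t
  have sub: "set_pmf (\<mu> t) \<subseteq> carrier zero_section" and sym: "map_pmf wr_inv (\<mu> t) = \<mu> t"
    if "1 \<le> t" for t
    using adm that by (auto simp: admissible_walks_def symmetric_pmf_zero_section)
  have metric: "zs_metric g \<one>\<^bsub>zero_section\<^esub> = real (wr_norm g)"
    if "1 \<le> t" "g \<in> set_pmf (\<mu> t)" for t g
    using sub[OF that(1)] that(2) by (auto simp: one_zero_section word_metric_one carrier_zero_section)
  have int: "integrable (measure_pmf (\<mu> t)) (\<lambda>g. real (wr_norm g) powr p)" if t: "1 \<le> t" for t
  proof -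
    have "integrable (measure_pmf (\<mu> t)) (\<lambda>x. zs_metric x \<one>\<^bsub>zero_section\<^esub> powr p)"
      using adm t by (auto simp: admissible_walks_def)
    then show ?thesis
      by (rule Bochner_Integration.integrable_bound) (auto simp: AE_measure_pmf_iff metric[OF t])
  qed
  \<comment> \<open>Norms of non-identity elements are at least 1, so \<open>S t\<close> dominates the quantity that
    tends to infinity by admissibility.\<close>
  have S_top: "filterlim S at_top sequentially"
  proof (rule filterlim_at_top_mono)
    show "filterlim (\<lambda>t. real t * measure_pmf.prob (\<mu> t) (carrier zero_section - {\<one>\<^bsub>zero_section\<^esub>}))
        at_top sequentially"
      using adm by (simp add: admissible_walks_def)
    show "\<forall>\<^sub>F t in sequentially.
        real t * measure_pmf.prob (\<mu> t) (carrier zero_section - {\<one>\<^bsub>zero_section\<^esub>}) \<le> S t"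
      using eventually_ge_at_top[of 1]
    proof eventually_elim
      case (elim t)
      let ?A = "carrier zero_section - {\<one>\<^bsub>zero_section\<^esub>}"
      have "indicator ?A g \<le> real (wr_norm g) powr p" for g
      proof (cases "g \<in> ?A")
        case True
        then have "wr_norm g \<noteq> 0"
          using wr_norm_eq_0[of g] by (auto simp: one_zero_section carrier_zero_section)
        then have "1 \<le> real (wr_norm g)" by linarith
        then show ?thesis using p True by (simp add: ge_one_powr_ge_zero)
      qed simp
      then have "measure_pmf.expectation (\<mu> t) (indicator ?A)
          \<le> measure_pmf.expectation (\<mu> t) (\<lambda>g. real (wr_norm g) powr p)"
        by (intro integral_mono int[OF elim] measure_pmf.integrable_const_bound[of _ 1])
          (simp_all add: indicator_def)
      then show ?case
        unfolding S_def by (intro mult_left_mono) simp_all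
    qed
  qed
  have e_nonneg: "0 \<le> e t" for t unfolding e_def by simp
  have "\<forall>\<^sub>F t in sequentially. ereal
      (ln (measure_pmf.expectation (walk zero_section (\<mu> t) t) (\<lambda>x. zs_metric x \<one>\<^bsub>zero_section\<^esub>)) /
       ln (real t * measure_pmf.expectation (walk zero_section (\<mu> t) 1)
         (\<lambda>x. zs_metric x \<one>\<^bsub>zero_section\<^esub> powr p)))
      \<le> ereal ((2 / (p + 1) * ln (S t) + ln 9) / (1 * ln (S t) + 0))"
    using eventually_ge_at_top[of 1] filterlim_at_top_dense[THEN iffD1, OF S_top, rule_format, of 1]
  proof eventually_elim
    case (elim t)
    have "e t \<le> 9 * S t powr (2 / (p + 1))"
      unfolding e_def using elim
      by (intro expectation_norm_le[OF sub sym int p S_def]) auto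
    moreover have "0 < 9 * S t powr (2 / (p + 1))"
      using elim by simp
    moreover have ln9: "ln (9 * S t powr (2 / (p + 1))) = 2 / (p + 1) * ln (S t) + ln 9"
      using elim by (subst ln_mult) (auto simp: ln_powr)
    ultimately have "ln (e t) \<le> 2 / (p + 1) * ln (S t) + ln 9" if "e t \<noteq> 0"
      using ln_le_cancel_iff[of "e t" "9 * S t powr (2 / (p + 1))"] e_nonneg[of t] that by linarith
    moreover have "0 \<le> 2 / (p + 1) * ln (S t) + ln 9"
      using elim p by (intro add_nonneg_nonneg mult_nonneg_nonneg) auto
    \<comment> \<open>The case \<open>e t = 0\<close> falls under the convention \<open>ln 0 = 0\<close>.\<close>
    ultimately have "ln (e t) \<le> 2 / (p + 1) * ln (S t) + ln 9"
      by (cases "e t = 0") auto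
    then show ?case
      using elim unfolding expectation_walk[OF sub[OF elim(1)]] expectation_walk_one[OF sub[OF elim(1)]]
      by (simp add: e_def[symmetric] S_def[symmetric] divide_right_mono)
  qed
  then have "beta_star_seq zero_section zs_metric p \<mu>
      \<le> limsup (\<lambda>t. ereal ((2 / (p + 1) * ln (S t) + ln 9) / (1 * ln (S t) + 0)))"
    unfolding beta_star_seq_def by (rule Limsup_mono)
  also have "\<dots> = ereal (2 / (p + 1) / 1)"
    by (intro lim_imp_Limsup tendsto_ereal ratio_of_affine_tendsto
        filterlim_compose[OF ln_at_top S_top]) auto
  finally show ?thesis by simp
qed

lemma spread_pmf_admissible:
  assumes "0 \<le> p"
  shows "spread_pmf \<in> admissible_walks zero_section zs_metric p"
proof -
  have int: "integrable (measure_pmf (spread_pmf t)) (\<lambda>x. zs_metric x \<one>\<^bsub>zero_section\<^esub> powr p)"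
    if "1 \<le> t" for t
    by (rule integrable_measure_pmf_finite) (use that in \<open>simp add: set_spread_pmf\<close>)
  have prob: "measure_pmf.prob (spread_pmf t) (carrier zero_section - {\<one>\<^bsub>zero_section\<^esub>}) = 1"
    if "1 \<le> t" for t
  proof -
    have "g \<noteq> \<one>\<^bsub>zero_section\<^esub>" if g: "g \<in> set_pmf (spread_pmf t)" for g
      using spread_pmf_norm(1)[OF \<open>1 \<le> t\<close> g] wr_norm_one \<open>1 \<le> t\<close> by (auto simp: one_zero_section)
    then show ?thesis
      using set_spread_pmf_carrier[OF that]
      by (subst measure_pmf.prob_eq_1) (auto simp: AE_measure_pmf_iff)
  qed
  have "filterlim (\<lambda>t. real t * measure_pmf.prob (spread_pmf t)
      (carrier zero_section - {\<one>\<^bsub>zero_section\<^esub>})) at_top sequentially"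
    by (rule filterlim_at_top_mono[OF filterlim_real_sequentially])
      (use eventually_ge_at_top[of 1] in eventually_elim, simp add: prob)
  then show ?thesis
    using int set_spread_pmf_carrier spread_pmf_symmetric
    by (auto simp: admissible_walks_def symmetric_pmf_zero_section)
qed

lemma beta_star_seq_spread_pmf_ge:
  assumes p: "0 \<le> p"
  shows "ereal (2 / (p + 1)) \<le> beta_star_seq zero_section zs_metric p spread_pmf"
proof -
  define S where "S t = real t * measure_pmf.expectation (spread_pmf t) (\<lambda>g. real (wr_norm g) powr p)" for t
  define e where "e t = measure_pmf.expectation (replicate_pmf t (spread_pmf t))
    (\<lambda>gs. real (wr_norm (\<lambda>z. \<Sum>g\<leftarrow>gs. fst g z, 0)))" for t
  let ?L = "\<lambda>t. ln (real t)"
  have L_top: "filterlim ?L at_top sequentially"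
    by (rule filterlim_compose[OF ln_at_top filterlim_real_sequentially])
  have "ereal (2 / (p + 1)) = limsup (\<lambda>t. ereal ((2 * ?L t + - ln 4) / ((p + 1) * ?L t + p * ln 7)))"
    by (intro lim_imp_Limsup[symmetric] tendsto_ereal ratio_of_affine_tendsto L_top) (use p in auto)
  also have "\<dots> \<le> beta_star_seq zero_section zs_metric p spread_pmf"
    unfolding beta_star_seq_def
  proof (rule Limsup_mono)
    show "\<forall>\<^sub>F t in sequentially. ereal ((2 * ?L t + - ln 4) / ((p + 1) * ?L t + p * ln 7)) \<le> ereal
      (ln (measure_pmf.expectation (walk zero_section (spread_pmf t) t) (\<lambda>x. zs_metric x \<one>\<^bsub>zero_section\<^esub>)) /
       ln (real t * measure_pmf.expectation (walk zero_section (spread_pmf t) 1)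
         (\<lambda>x. zs_metric x \<one>\<^bsub>zero_section\<^esub> powr p)))"
      using eventually_ge_at_top[of 2]
    proof eventually_elim
      case (elim t)
      then have t: "1 \<le> t" and t1: "1 < real t" by auto
      note E = expectation_spread_pmf_powr[OF t p]
      have "1 * 1 < real t * real t powr p"
        using t1 p by (intro mult_less_le_imp_less) (auto simp: ge_one_powr_ge_zero)
      also have "\<dots> \<le> S t"
        unfolding S_def using E(2) by (intro mult_left_mono) auto
      finally have S1: "1 < S t" by simp
      have "S t \<le> real t * (7 * real t) powr p"
        unfolding S_def using E(3) by (intro mult_left_mono) auto
      then have "ln (S t) \<le> ln (real t * (7 * real t) powr p)"
        using S1 by simp
      also have "\<dots> = (p + 1) * ?L t + p * ln 7"
        using t1 by (simp add: ln_mult ln_powr algebra_simps)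
      finally have lnS: "ln (S t) \<le> (p + 1) * ?L t + p * ln 7" .
      have "0 < (real t)\<^sup>2 / 4" "(real t)\<^sup>2 / 4 \<le> e t"
        using expectation_norm_spread_pmf_ge[OF elim] t1 unfolding e_def by auto
      then have "ln ((real t)\<^sup>2 / 4) \<le> ln (e t)"
        by (subst ln_le_cancel_iff) linarith+
      moreover have "ln ((real t)\<^sup>2 / 4) = 2 * ?L t + - ln 4"
        using t1 by (simp add: ln_div ln_realpow)
      ultimately have lne: "2 * ?L t + - ln 4 \<le> ln (e t)" by simp
      have "ln 4 = 2 * ln (2 :: real)"
        using ln_realpow[of 2 2] by simp
      then have "0 \<le> 2 * ?L t + - ln 4"
        using elim by simp
      then have "0 \<le> ln (e t)"
        using lne by linarith
      then have "(2 * ?L t + - ln 4) / ((p + 1) * ?L t + p * ln 7) \<le> ln (e t) / ln (S t)"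
        using S1 by (intro frac_le lnS lne) auto
      then show ?case
        unfolding expectation_walk[OF set_spread_pmf_carrier[OF t]]
          expectation_walk_one[OF set_spread_pmf_carrier[OF t]] e_def S_def by simp
    qed
  qed
  finally show ?thesis .
qed

theorem mainTheorem8:
  fixes p :: real
  assumes "1 \<le> p" "p \<le> 2"
  shows "beta_star zero_section (word_metric wreath_ZZ wreath_ZZ_gens) p = ereal (2 / (p + 1))"
proof (rule antisym)
  show "beta_star zero_section zs_metric p \<le> ereal (2 / (p + 1))"
    unfolding beta_star_def using assms by (intro SUP_least beta_star_seq_le)
  have "beta_star_seq zero_section zs_metric p spread_pmf \<le> beta_star zero_section zs_metric p"
    unfolding beta_star_def using assms by (intro SUP_upper spread_pmf_admissible) simp
  then show "ereal (2 / (p + 1)) \<le> beta_star zero_section zs_metric p"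
    using beta_star_seq_spread_pmf_ge[of p] assms by (meson order_trans zero_le_one)
qed

end
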